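(* Let $L$ be an even lattice of signature $(2,b)$ and let $\widetilde{O}^+(L)$ be its stable orthogonal group. If $\widetilde{O}^+(L)$ has an irregular cusp, then, as an abelian group, $L^\vee/L\simeq \mathbb{Z}/8\oplus(\mathbb{Z}/2)^{\oplus a}$ or $L^\vee/L\simeq(\mathbb{Z}/4)^{\oplus 2}\oplus(\mathbb{Z}/2)^{\oplus a}$ for some integer $a\ge 0$. Conversely, if $L=U\oplus\langle -8\rangle\oplus M$ or $L=U\oplus\langle -4\rangle^{\oplus 2}\oplus M$ with $M^\vee/M$ 2-elementary, then $\widetilde{O}^+(L)$ has an irregular $0$-dimensional cusp.
   Context: A lattice is a free $\mathbb{Z}$-module of finite rank with a nondegenerate integral symmetric bilinear form $(\cdot,\cdot)$; it is even if $(l,l)\in 2\mathbb{Z}$ for all $l$. $L^\vee=\mathrm{Hom}(L,\mathbb{Z})\supset L$ is the dual lattice. $U$ is the even unimodular lattice with Gram matrix $\begin{pmatrix}0&1\\1&0\end{pmatrix}$, and $\langle n\rangle$ is the rank one lattice with a generator of norm $n$. In the converse part $M$ is an even lattice such that $L$ has signature $(2,b)$ (so $M$ is hyperbolic, i.e. has exactly one positive direction). For $L$ of signature $(2,b)$, $\mathcal{D}$ is a fixed connected component (of two) of $\{\mathbb{C}\omega\in\mathbb{P}L_{\mathbb{C}} : (\omega,\omega)=0,\ (\omega,\bar\omega)>0\}$; $O^+(L)\subset O(L)$ and $O^+(L_{\mathbb{Q}})\subset O(L_{\mathbb{Q}})$ are the subgroups preserving $\mathcal{D}$. The stable orthogonal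 group $\widetilde{O}^+(L)$ is the kernel of $O^+(L)\to O(L^\vee/L)$. Let $\Gamma<O^+(L)$ be a finite-index subgroup and $\langle\Gamma,-\mathrm{id}\rangle$ the group generated by $\Gamma$ and $-\mathrm{id}$. A $0$-dimensional cusp is a rank $1$ primitive isotropic sublattice $I\subset L$ (primitive: $L/I$ is free; isotropic: $(I,I)=0$). Let $U(I)_{\mathbb{Q}}$ be the group of $g\in O^+(L_{\mathbb{Q}})$ which preserve $I$ and act trivially on $I$ and on $I_{\mathbb{Q}}^\perp/I_{\mathbb{Q}}$. The cusp $I$ is irregular for $\Gamma$ if $U(I)_{\mathbb{Q}}\cap\Gamma\neq U(I)_{\mathbb{Q}}\cap\langle\Gamma,-\mathrm{id}\rangle$. A $1$-dimensional cusp is a rank $2$ primitive isotropic sublattice $J\subset L$. Let $U(J)_{\mathbb{Q}}$ be the group of $g\in O^+(L_{\mathbb{Q}})$ acting trivially on $J_{\mathbb{Q}}^\perp$. The cusp $J$ is irregular for $\Gamma$ if $U(J)_{\mathbb{Q}}\cap\Gamma\ne U(J)_{\mathbb{Q}}\cap\langle\Gamma,-\mathrm{id}\rangle$. "$\Gamma$ has an irregular cusp" means that some $0$- or $1$-dimensional cusp is irregular for $\Gamma$. *)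

theory Defs
  imports "HOL-Analysis.Analysis" "HOL-Algebra.Algebra"
begin

text \<open>
  A lattice of positive rank is given by the Gram matrix \<open>S\<close> of its form with respect to a
  \<open>\<int>\<close>-basis indexed by the finite type \<open>'n\<close>.  So \<open>L = \<int>\<^sup>n\<close>, and its scalar extensions
  \<open>L\<^sub>\<rat>\<close>, \<open>L\<^sub>\<real>\<close>, \<open>L\<^sub>\<complex>\<close> are \<open>rat ^ 'n\<close>, \<open>real ^ 'n\<close>, \<open>complex ^ 'n\<close>; all of them carry the
  (bilinear) extension \<open>bform S\<close> of the form.
\<close>

definition bform :: "int ^ 'n ^ 'n \<Rightarrow> 'a::comm_ring_1 ^ 'n \<Rightarrow> 'a ^ 'n \<Rightarrow> 'a" where
  "bform S x y = (\<Sum>i\<in>UNIV. \<Sum>j\<in>UNIV. of_int (S $ i $ j) * x $ i * y $ j)"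

definition even_lattice :: "int ^ 'n ^ 'n \<Rightarrow> bool" where
  "even_lattice S \<longleftrightarrow>
     (\<forall>x y :: int ^ 'n. bform S x y = bform S y x) \<and>
     (\<forall>x :: int ^ 'n. (\<forall>y. bform S x y = 0) \<longrightarrow> x = 0) \<and>
     (\<forall>x :: int ^ 'n. even (bform S x x))"

definition has_signature :: "int ^ 'n ^ 'n \<Rightarrow> nat \<Rightarrow> nat \<Rightarrow> bool" where
  "has_signature S p q \<longleftrightarrow> (\<exists>v :: 'n \<Rightarrow> real ^ 'n.
     inj v \<and> independent (range v) \<and>
     (\<forall>i j. i \<noteq> j \<longrightarrow> bform S (v i) (v j) = 0) \<and>
     card {i. bform S (v i) (v i) > 0} = p \<and>
     card {i. bform S (v i) (v i) < 0} = q \<and>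
     p + q = CARD('n))"

definition lattice_iso :: "int ^ 'n ^ 'n \<Rightarrow> int ^ 'm ^ 'm \<Rightarrow> bool" (infix \<open>\<simeq>\<^sub>L\<close> 50) where
  "S \<simeq>\<^sub>L T \<longleftrightarrow> (\<exists>f :: int ^ 'n \<Rightarrow> int ^ 'm. bij f \<and>
     (\<forall>x y. f (x + y) = f x + f y) \<and>
     (\<forall>x y. bform T (f x) (f y) = bform S x y))"

definition orth_sum :: "int ^ 'n ^ 'n \<Rightarrow> int ^ 'm ^ 'm \<Rightarrow> int ^ ('n + 'm) ^ ('n + 'm)"
    (infixr \<open>\<oplus>\<^sub>L\<close> 65) where
  "S \<oplus>\<^sub>L T = (\<chi> i j. case (i, j) of
     (Inl a, Inl b) \<Rightarrow> S $ a $ b | (Inr a, Inr b) \<Rightarrow> T $ a $ b | _ \<Rightarrow> 0)"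

definition lattice_U :: "int ^ 2 ^ 2" where
  "lattice_U = vector [vector [0, 1], vector [1, 0]]"

definition rank_one :: "int \<Rightarrow> int ^ 1 ^ 1" where
  "rank_one n = (\<chi> i j. n)"

text \<open>The lattice \<open>L\<close> as a subset of \<open>L\<^sub>\<rat>\<close>.\<close>

definition int_vecs :: "(rat ^ 'n) set" where
  "int_vecs = {x. \<forall>i. x $ i \<in> \<int>}"

text \<open>
  Since the form is nondegenerate, \<open>Hom(L,\<int>)\<close> is identified with the set of those
  \<open>x \<in> L\<^sub>\<rat>\<close> for which \<open>(x, \<cdot>)\<close> is integral on \<open>L\<close>.
\<close>

definition dual_lattice :: "int ^ 'n ^ 'n \<Rightarrow> (rat ^ 'n) set" where
  "dual_lattice S = {x. \<forall>y\<in>int_vecs. bform S x y \<in> \<int>}"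

definition add_group :: "'a::ab_group_add set \<Rightarrow> 'a monoid" where
  "add_group A = \<lparr>carrier = A, mult = (+), one = 0\<rparr>"

definition disc_group :: "int ^ 'n ^ 'n \<Rightarrow> (rat ^ 'n) set monoid" where
  "disc_group S = add_group (dual_lattice S) Mod int_vecs"

definition group_power :: "'a monoid \<Rightarrow> nat \<Rightarrow> (nat \<Rightarrow> 'a) monoid" where
  "group_power G k = product_group {..<k} (\<lambda>_. G)"

definition two_elementary :: "'a monoid \<Rightarrow> bool" where
  "two_elementary G \<longleftrightarrow> (\<forall>x\<in>carrier G. x \<otimes>\<^bsub>G\<^esub> x = \<one>\<^bsub>G\<^esub>)"

definition cline :: "complex ^ 'n \<Rightarrow> (complex ^ 'n) set" where
  "cline w = range (\<lambda>c. c *s w)"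

definition proj_space :: "(complex ^ 'n) set topology" where
  "proj_space = topology (\<lambda>T. T \<subseteq> cline ` (- {0}) \<and> open {w. w \<noteq> 0 \<and> cline w \<in> T})"

lemma openin_proj_space:
  "openin proj_space (T :: (complex ^ 'n) set set) \<longleftrightarrow>
     T \<subseteq> cline ` (- {0}) \<and> open {w. w \<noteq> 0 \<and> cline w \<in> T}"
proof -
  have "istopology (\<lambda>T :: (complex ^ 'n) set set.
          T \<subseteq> cline ` (- {0}) \<and> open {w. w \<noteq> 0 \<and> cline w \<in> T})"
    unfolding istopology_def
  proof (intro conjI allI impI)
    fix A B :: "(complex ^ 'n) set set"
    assume A: "A \<subseteq> cline ` (- {0}) \<and> open {w. w \<noteq> 0 \<and> cline w \<in> A}"
      and B: "B \<subseteq> cline ` (- {0}) \<and> open {w. w \<noteq> 0 \<and> cline w \<in> B}"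
    show "A \<inter> B \<subseteq> cline ` (- {0})" using A by blast
    have "{w. w \<noteq> 0 \<and> cline w \<in> A \<inter> B} =
          {w. w \<noteq> 0 \<and> cline w \<in> A} \<inter> {w. w \<noteq> 0 \<and> cline w \<in> B}" by blast
    then show "open {w. w \<noteq> 0 \<and> cline w \<in> A \<inter> B}"
      using open_Int[OF conjunct2[OF A] conjunct2[OF B]] by (simp only:)
  next
    fix K :: "(complex ^ 'n) set set set"
    assume K: "\<forall>A\<in>K. A \<subseteq> cline ` (- {0}) \<and> open {w. w \<noteq> 0 \<and> cline w \<in> A}"
    show "\<Union>K \<subseteq> cline ` (- {0})" using K by blast
    have "{w. w \<noteq> 0 \<and> cline w \<in> \<Union>K} = (\<Union>A\<in>K. {w. w \<noteq> 0 \<and> cline w \<in> A})" by blast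
    moreover have "open (\<Union>A\<in>K. {w. w \<noteq> 0 \<and> cline w \<in> A})" using K by (intro open_UN) blast
    ultimately show "open {w. w \<noteq> 0 \<and> cline w \<in> \<Union>K}" by (simp only:)
  qed
  from topology_inverse'[OF this] show ?thesis by (simp only: proj_space_def)
qed

lemma topspace_proj_space: "topspace (proj_space :: (complex ^ 'n) set topology) = cline ` (- {0})"
proof -
  have "{w :: complex ^ 'n. w \<noteq> 0 \<and> cline w \<in> cline ` (- {0})} = - {0}" by auto
  then have "openin proj_space (cline ` (- {0 :: complex ^ 'n}))"
    by (simp add: openin_proj_space open_Compl)
  then have "cline ` (- {0 :: complex ^ 'n}) \<subseteq> topspace proj_space"
    by (rule openin_subset)
  moreover have "topspace proj_space \<subseteq> cline ` (- {0 :: complex ^ 'n})"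
    using openin_topspace[of "proj_space :: (complex ^ 'n) set topology"]
    unfolding openin_proj_space by (rule conjunct1)
  ultimately show ?thesis by (intro equalityI)
qed

text \<open>\<open>proj_space\<close> is the complex projective space with its usual quotient topology.\<close>

lemma quotient_map_cline:
  "quotient_map (top_of_set (- {0 :: complex ^ 'n})) proj_space cline"
proof -
  have eq: "{w \<in> - {0 :: complex ^ 'n}. cline w \<in> T} = {w. w \<noteq> 0 \<and> cline w \<in> T}" for T by auto
  have op: "openin (top_of_set (- {0 :: complex ^ 'n})) W \<longleftrightarrow> open W \<and> W \<subseteq> - {0}" for W
    by (simp add: openin_open_eq open_Compl)
  have "cline ` (- {0 :: complex ^ 'n}) = topspace proj_space"
    by (simp add: topspace_proj_space)
  moreover have "openin (top_of_set (- {0 :: complex ^ 'n})) {w. w \<noteq> 0 \<and> cline w \<in> T} \<longleftrightarrow>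
      openin proj_space T" if "T \<subseteq> topspace proj_space" for T
    using that unfolding op openin_proj_space topspace_proj_space by blast
  ultimately show ?thesis
    by (simp add: quotient_map_def eq)
qed

definition period_domain :: "int ^ 'n ^ 'n \<Rightarrow> (complex ^ 'n) set set" where
  "period_domain S = {cline w | w. w \<noteq> 0 \<and> bform S w w = 0 \<and>
     bform S w (\<chi> i. cnj (w $ i)) \<in> \<real> \<and> Re (bform S w (\<chi> i. cnj (w $ i))) > 0}"

definition period_components :: "int ^ 'n ^ 'n \<Rightarrow> (complex ^ 'n) set set set" where
  "period_components S = connected_components_of (subtopology proj_space (period_domain S))"

definition orth_group :: "int ^ 'n ^ 'n \<Rightarrow> (rat ^ 'n ^ 'n) monoid" where
  "orth_group S = \<lparr>carrier = {g. invertible g \<and> (\<forall>x y. bform S (g *v x) (g *v y) = bform S x y)},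
                   mult = (**), one = mat 1\<rparr>"

lemma group_orth_group: "group (orth_group S)"
proof (rule groupI)
  fix g assume g: "g \<in> carrier (orth_group S)"
  then obtain h where h: "g ** h = mat 1" "h ** g = mat 1"
    by (auto simp: orth_group_def invertible_def)
  have "bform S (h *v x) (h *v y) = bform S x y" for x y
  proof -
    have "bform S (g *v (h *v x)) (g *v (h *v y)) = bform S (h *v x) (h *v y)"
      using g by (simp add: orth_group_def)
    then show ?thesis using h by (simp add: matrix_vector_mul_assoc)
  qed
  then have "h \<in> carrier (orth_group S)" using h by (auto simp: orth_group_def invertible_def)
  then show "\<exists>h\<in>carrier (orth_group S). h \<otimes>\<^bsub>orth_group S\<^esub> g = \<one>\<^bsub>orth_group S\<^esub>"
    using h by (auto simp: orth_group_def)
next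
  have "invertible (mat 1 :: rat ^ 'n ^ 'n)" by (metis invertible_def matrix_mul_lid)
  then show "\<one>\<^bsub>orth_group S\<^esub> \<in> carrier (orth_group S)" by (simp add: orth_group_def)
next
  fix g h assume "g \<in> carrier (orth_group S)" "h \<in> carrier (orth_group S)"
  then have "invertible (g ** h)"
    and "\<And>x y. bform S (g *v (h *v x)) (g *v (h *v y)) = bform S x y"
    by (simp_all add: orth_group_def invertible_mult)
  then show "g \<otimes>\<^bsub>orth_group S\<^esub> h \<in> carrier (orth_group S)"
    by (simp add: orth_group_def matrix_vector_mul_assoc)
qed (simp_all add: orth_group_def matrix_mul_assoc)

definition act_line :: "rat ^ 'n ^ 'n \<Rightarrow> (complex ^ 'n) set \<Rightarrow> (complex ^ 'n) set" where
  "act_line g l = (\<lambda>w. (\<chi> i j. of_rat (g $ i $ j)) *v w) ` l"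

text \<open>
  \<open>D\<close> is the chosen component of the period domain.  All subgroups of \<open>O(L)\<close> are regarded as
  sets of matrices in \<open>O(L\<^sub>\<rat>)\<close>, so that they can be intersected with \<open>U(I)\<^sub>\<rat>\<close>, \<open>U(J)\<^sub>\<rat>\<close>.
\<close>

definition O_plus_rat :: "int ^ 'n ^ 'n \<Rightarrow> (complex ^ 'n) set set \<Rightarrow> (rat ^ 'n ^ 'n) set" where
  "O_plus_rat S D = {g \<in> carrier (orth_group S). act_line g ` D = D}"

definition O_plus :: "int ^ 'n ^ 'n \<Rightarrow> (complex ^ 'n) set set \<Rightarrow> (rat ^ 'n ^ 'n) set" where
  "O_plus S D = {g \<in> O_plus_rat S D. (*v) g ` int_vecs = int_vecs}"

definition stable_O_plus :: "int ^ 'n ^ 'n \<Rightarrow> (complex ^ 'n) set set \<Rightarrow> (rat ^ 'n ^ 'n) set" where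
  "stable_O_plus S D = {g \<in> O_plus S D. \<forall>x\<in>dual_lattice S. g *v x - x \<in> int_vecs}"

definition cusp :: "int ^ 'n ^ 'n \<Rightarrow> nat \<Rightarrow> (rat ^ 'n) set \<Rightarrow> bool" where
  "cusp S r I \<longleftrightarrow>
     subgroup I (add_group int_vecs) \<and>
     add_group I \<cong> group_power integer_group r \<and>
     (\<exists>k. add_group int_vecs Mod I \<cong> group_power integer_group k) \<and>
     (\<forall>x\<in>I. \<forall>y\<in>I. bform S x y = 0)"

definition perp_rat :: "int ^ 'n ^ 'n \<Rightarrow> (rat ^ 'n) set \<Rightarrow> (rat ^ 'n) set" where
  "perp_rat S I = {x. \<forall>y\<in>vec.span I. bform S x y = 0}"

definition U0_rat ::
    "int ^ 'n ^ 'n \<Rightarrow> (complex ^ 'n) set set \<Rightarrow> (rat ^ 'n) set \<Rightarrow> (rat ^ 'n ^ 'n) set" where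
  "U0_rat S D I = {g \<in> O_plus_rat S D.
     (*v) g ` I = I \<and> (\<forall>x\<in>I. g *v x = x) \<and> (\<forall>x\<in>perp_rat S I. g *v x - x \<in> vec.span I)}"

definition U1_rat ::
    "int ^ 'n ^ 'n \<Rightarrow> (complex ^ 'n) set set \<Rightarrow> (rat ^ 'n) set \<Rightarrow> (rat ^ 'n ^ 'n) set" where
  "U1_rat S D J = {g \<in> O_plus_rat S D. \<forall>x\<in>perp_rat S J. g *v x = x}"

definition with_neg_id :: "int ^ 'n ^ 'n \<Rightarrow> (rat ^ 'n ^ 'n) set \<Rightarrow> (rat ^ 'n ^ 'n) set" where
  "with_neg_id S \<Gamma> = generate (orth_group S) (insert (- mat 1) \<Gamma>)"

definition has_irregular_cusp0 ::
    "int ^ 'n ^ 'n \<Rightarrow> (complex ^ 'n) set set \<Rightarrow> (rat ^ 'n ^ 'n) set \<Rightarrow> bool" where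
  "has_irregular_cusp0 S D \<Gamma> \<longleftrightarrow>
     (\<exists>I. cusp S 1 I \<and> U0_rat S D I \<inter> \<Gamma> \<noteq> U0_rat S D I \<inter> with_neg_id S \<Gamma>)"

definition has_irregular_cusp1 ::
    "int ^ 'n ^ 'n \<Rightarrow> (complex ^ 'n) set set \<Rightarrow> (rat ^ 'n ^ 'n) set \<Rightarrow> bool" where
  "has_irregular_cusp1 S D \<Gamma> \<longleftrightarrow>
     (\<exists>J. cusp S 2 J \<and> U1_rat S D J \<inter> \<Gamma> \<noteq> U1_rat S D J \<inter> with_neg_id S \<Gamma>)"

definition has_irregular_cusp ::
    "int ^ 'n ^ 'n \<Rightarrow> (complex ^ 'n) set set \<Rightarrow> (rat ^ 'n ^ 'n) set \<Rightarrow> bool" where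
  "has_irregular_cusp S D \<Gamma> \<longleftrightarrow> has_irregular_cusp0 S D \<Gamma> \<or> has_irregular_cusp1 S D \<Gamma>"

end

theory Submission
  imports Defs
begin

text \<open>
  Let \<open>\<Gamma>\<close> be the stable orthogonal group and \<open>A = L\<^sup>\<or>/L\<close>.  A cusp is irregular for \<open>\<Gamma>\<close> exactly
  when some \<open>g\<close> in its unipotent group has \<open>- g \<in> \<Gamma>\<close> but \<open>g \<notin> \<Gamma>\<close>, that is, when \<open>g\<close> preserves \<open>L\<close> and acts
  on \<open>A\<close> as \<open>-1\<close>, while \<open>-1\<close> is not the identity of \<open>A\<close>.  The unipotent group of a plane \<open>J\<close> is
  contained in that of every line in \<open>J\<close> (lemma \<open>trivial_on_plane_perp\<close>), so only a primitive
  isotropic vector \<open>e\<close> with \<open>g e = e\<close> and \<open>g x - x \<in> \<rat>e\<close> for \<open>x \<bottom> e\<close> matters.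

  Choose \<open>y \<in> L\<^sup>\<or>\<close> with \<open>(e, y) = 1\<close> and put \<open>u = g y - y\<close>, \<open>N = (u, u)\<close>.  Then \<open>g x = x - (x, u) e\<close>
  for \<open>x \<bottom> e\<close>, and \<open>L\<^sup>\<or> = \<int>y + (L\<^sup>\<or> \<inter> e\<^sup>\<bottom>)\<close>.  Since \<open>g + 1\<close> maps \<open>L\<^sup>\<or>\<close> into \<open>L\<close>, so does \<open>g\<^sup>2 - 1\<close>, and because
  \<open>\<rat>e \<inter> L = \<int>e\<close> this makes \<open>2 N\<close> and all \<open>2 (x, u)\<close> with \<open>x \<bottom> e\<close> integral.  Thus \<open>2 A\<close> is generated
  by \<open>2 y\<close> and the classes \<open>2 x = (x, u) e\<close> for \<open>x \<bottom> e\<close>, which are \<open>0\<close> or \<open>e/2\<close>.  If \<open>N\<close> is not integral, then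
  \<open>4 y = e/2\<close> in \<open>A\<close> and \<open>2 A\<close> is cyclic of order 4.  If \<open>N\<close> is integral, then \<open>4 A = 0\<close>, and evenness
  of \<open>L\<close> together with \<open>2 A \<noteq> 0\<close> forces \<open>2 A = {0, 2 y, e/2, 2 y + e/2}\<close> with four distinct elements.  This is
  \<open>unipotent_acting_as_minus_one\<close>.  A finite abelian group whose doubled group is that of an embedded
  \<open>\<int>/8\<close> or \<open>(\<int>/4)\<^sup>2\<close> is the product of this subgroup with copies of \<open>\<int>/2\<close>
  (lemma \<open>split_off_involutions\<close>).

  For the converse the same analysis tells which \<open>e\<close> and \<open>u\<close> to look for.  With \<open>e\<^sub>0, f\<^sub>0\<close> the basis
  of \<open>U\<close>, and \<open>v\<close>, \<open>v\<^sub>1\<close>, \<open>v\<^sub>2\<close> generators of the rank one summands, the Eichler transvections with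
  \<open>e = 2 e\<^sub>0 + 2 f\<^sub>0 + v\<close>, \<open>u = e\<^sub>0 + v/4\<close>, respectively \<open>e = 2 e\<^sub>0 + 2 f\<^sub>0 + v\<^sub>1 + v\<^sub>2\<close>, \<open>u = e\<^sub>0 + v\<^sub>1/2\<close>,
  preserve \<open>L\<close> and act on \<open>A\<close> as \<open>-1\<close>.  A transvection preserves the chosen component of the period
  domain because scaling \<open>u\<close> joins it to the identity (lemma \<open>transvection_stays_in_component\<close>).
\<close>

section \<open>Splitting involutions off a finite abelian group\<close>

lemma carrier_group_power [simp]: "carrier (group_power G k) = (\<Pi>\<^sub>E i\<in>{..<k}. carrier G)"
  by (simp add: group_power_def)

lemma mult_group_power [simp]:
  "f \<otimes>\<^bsub>group_power G k\<^esub> f' = (\<lambda>i\<in>{..<k}. f i \<otimes>\<^bsub>G\<^esub> f' i)"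
  by (simp add: group_power_def)

lemma group_group_power: "group G \<Longrightarrow> group (group_power G k)"
  by (simp add: group_power_def)

text \<open>
  The new last coordinate records whether the factor \<open>w\<close> occurs.  Because \<open>w\<close> lies outside the image
  of \<open>h\<close>, that coordinate can be read off from the value.
\<close>

lemma adjoin_involution:
  fixes P :: "'p monoid" and G :: "'g monoid"
  assumes "comm_group G" "group P"
    and h: "h \<in> hom (P \<times>\<times> group_power (integer_mod_group 2) a) G"
    and inj: "inj_on h (carrier (P \<times>\<times> group_power (integer_mod_group 2) a))"
    and w: "w \<in> carrier G" "w \<notin> h ` carrier (P \<times>\<times> group_power (integer_mod_group 2) a)"
    and ww: "w \<otimes>\<^bsub>G\<^esub> w = \<one>\<^bsub>G\<^esub>"
  defines "h' \<equiv> \<lambda>(p, f). h (p, restrict f {..<a}) \<otimes>\<^bsub>G\<^esub> (if f a = 0 then \<one>\<^bsub>G\<^esub> else w)"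
  shows "h' \<in> hom (P \<times>\<times> group_power (integer_mod_group 2) (Suc a)) G"
    and "inj_on h' (carrier (P \<times>\<times> group_power (integer_mod_group 2) (Suc a)))"
    and "h ` carrier (P \<times>\<times> group_power (integer_mod_group 2) a) \<subseteq>
         h' ` carrier (P \<times>\<times> group_power (integer_mod_group 2) (Suc a))"
proof -
  interpret G: comm_group G by fact
  let ?Z = "integer_mod_group 2"
  let ?Q = "P \<times>\<times> group_power ?Z a"
  let ?Q' = "P \<times>\<times> group_power ?Z (Suc a)"
  have grpQ: "group ?Q" by (intro DirProd_group group_group_power assms) simp
  interpret h: group_hom ?Q G h
    using h grpQ by (simp add: group_hom_def group_hom_axioms_def)
  have Z: "carrier ?Z = {0, 1}" by (auto simp: carrier_integer_mod_group)
  have res: "(p, restrict f {..<a}) \<in> carrier ?Q" if "(p, f) \<in> carrier ?Q'" for p f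
    using that by (auto simp: PiE_iff)
  have bit: "f a = 0 \<or> f a = 1" if "(p, f) \<in> carrier ?Q'" for p f
  proof -
    from that have "f a \<in> carrier ?Z" by (auto simp: PiE_iff)
    then show ?thesis by (auto simp: Z)
  qed
  have bitmul: "(if (f a + f' a) mod 2 = (0::int) then \<one>\<^bsub>G\<^esub> else w) =
      (if f a = 0 then \<one>\<^bsub>G\<^esub> else w) \<otimes>\<^bsub>G\<^esub> (if f' a = 0 then \<one>\<^bsub>G\<^esub> else w)"
    if "(p, f) \<in> carrier ?Q'" "(p', f') \<in> carrier ?Q'" for p f p' f'
    using bit[OF that(1)] bit[OF that(2)] w ww by auto
  show "h' \<in> hom ?Q' G"
  proof (rule homI)
    fix x assume x: "x \<in> carrier ?Q'"
    obtain p f where pf: "x = (p, f)" by (cases x)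
    show "h' x \<in> carrier G"
      using x h.hom_closed[OF res[of p f]] w(1) unfolding pf h'_def by (simp del: carrier_DirProd)
  next
    fix x x' assume x: "x \<in> carrier ?Q'" and x': "x' \<in> carrier ?Q'"
    obtain p f where pf: "x = (p, f)" by (cases x)
    obtain p' f' where pf': "x' = (p', f')" by (cases x')
    have 1: "(p, restrict f {..<a}) \<in> carrier ?Q" and 2: "(p', restrict f' {..<a}) \<in> carrier ?Q"
      using res x x' pf pf' by auto
    have "restrict (\<lambda>i\<in>{..<Suc a}. (f i + f' i) mod 2) {..<a} =
          (\<lambda>i\<in>{..<a}. (restrict f {..<a} i + restrict f' {..<a} i) mod 2)"
      by (auto simp: restrict_def)
    then have *: "h' (x \<otimes>\<^bsub>?Q'\<^esub> x') =
       h ((p, restrict f {..<a}) \<otimes>\<^bsub>?Q\<^esub> (p', restrict f' {..<a})) \<otimes>\<^bsub>G\<^esub>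
       (if (f a + f' a) mod 2 = (0::int) then \<one>\<^bsub>G\<^esub> else w)"
      unfolding pf pf' h'_def by simp
    have m4: "(A \<otimes>\<^bsub>G\<^esub> B) \<otimes>\<^bsub>G\<^esub> (C \<otimes>\<^bsub>G\<^esub> E) = (A \<otimes>\<^bsub>G\<^esub> C) \<otimes>\<^bsub>G\<^esub> (B \<otimes>\<^bsub>G\<^esub> E)"
      if "A \<in> carrier G" "B \<in> carrier G" "C \<in> carrier G" "E \<in> carrier G" for A B C E
      using that by (simp add: G.m_ac)
    have c: "(if f a = 0 then \<one>\<^bsub>G\<^esub> else w) \<in> carrier G" "(if f' a = 0 then \<one>\<^bsub>G\<^esub> else w) \<in> carrier G"
      using w by auto
    show "h' (x \<otimes>\<^bsub>?Q'\<^esub> x') = h' x \<otimes>\<^bsub>G\<^esub> h' x'"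
      unfolding * h.hom_mult[OF 1 2] bitmul[OF x[unfolded pf] x'[unfolded pf']]
      unfolding pf pf' h'_def prod.case
      by (rule m4[OF h.hom_closed[OF 1] h.hom_closed[OF 2] c])
  qed
  show "inj_on h' (carrier ?Q')"
  proof (rule inj_onI)
    fix x x' assume x: "x \<in> carrier ?Q'" and x': "x' \<in> carrier ?Q'" and eq: "h' x = h' x'"
    obtain p f where pf: "x = (p, f)" by (cases x)
    obtain p' f' where pf': "x' = (p', f')" by (cases x')
    let ?q = "(p, restrict f {..<a})" and ?q' = "(p', restrict f' {..<a})"
    have 1: "?q \<in> carrier ?Q" and 2: "?q' \<in> carrier ?Q" using res x x' pf pf' by auto
    have c: "h ?q \<in> carrier G" "h ?q' \<in> carrier G" using h.hom_closed 1 2 by blast+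
    have eq': "h ?q \<otimes>\<^bsub>G\<^esub> (if f a = 0 then \<one>\<^bsub>G\<^esub> else w) =
               h ?q' \<otimes>\<^bsub>G\<^esub> (if f' a = 0 then \<one>\<^bsub>G\<^esub> else w)"
      using eq by (simp add: pf pf' h'_def)
    \<comment> \<open>If the last coordinates differed, then \<open>w\<close> would be a quotient of two values of \<open>h\<close>.\<close>
    have no: "\<not> (h r \<otimes>\<^bsub>G\<^esub> w = h s)" if "r \<in> carrier ?Q" "s \<in> carrier ?Q" for r s
    proof
      assume e: "h r \<otimes>\<^bsub>G\<^esub> w = h s"
      have hr: "h r \<in> carrier G" "h s \<in> carrier G" using h.hom_closed that by blast+
      have "w = inv\<^bsub>G\<^esub> h r \<otimes>\<^bsub>G\<^esub> h s" unfolding e[symmetric] 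
        using hr w(1) by (simp add: G.m_assoc[symmetric])
      also have "\<dots> = h (inv\<^bsub>?Q\<^esub> r \<otimes>\<^bsub>?Q\<^esub> s)"
        using that h.hom_mult[OF group.inv_closed[OF grpQ that(1)] that(2)] h.hom_inv[OF that(1)] by simp
      finally show False
        using w(2) that monoid.m_closed[OF group.is_monoid[OF grpQ] group.inv_closed[OF grpQ that(1)] that(2)]
        by blast
    qed
    have fa: "f a = f' a"
      using bit[OF x[unfolded pf]] bit[OF x'[unfolded pf']] eq' no[OF 1 2] no[OF 2 1] c w(1)
      by (auto simp del: carrier_DirProd split: if_splits)
    then have "h ?q = h ?q'"
      using eq' c w(1) by (auto split: if_splits)
    then have qq: "?q = ?q'" using inj 1 2 by (meson inj_onD)
    have "f i = f' i" for i
    proof (cases "i < a")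
      case True
      then show ?thesis using qq by (metis lessThan_iff prod.inject restrict_apply)
    next
      case False
      then show ?thesis
        using fa x x' by (cases "i = a") (auto simp: pf pf' PiE_iff extensional_def)
    qed
    then show "x = x'" using qq pf pf' by auto
  qed
  show "h ` carrier ?Q \<subseteq> h' ` carrier ?Q'"
  proof (rule image_subsetI)
    fix x assume x: "x \<in> carrier ?Q"
    obtain p f where pf: "x = (p, f)" by (cases x)
    let ?f = "f(a := 0)"
    have "restrict ?f {..<a} = f"
      using x by (fastforce simp: pf PiE_iff extensional_def restrict_def)
    moreover have "h (p, f) \<in> carrier G" using h.hom_closed x pf by blast
    ultimately have "h x = h' (p, ?f)" unfolding pf h'_def by simp
    moreover have "(p, ?f) \<in> carrier ?Q'"
      using x by (auto simp: pf PiE_iff extensional_def less_Suc_eq)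
    ultimately show "h x \<in> h' ` carrier ?Q'" by blast
  qed
qed

text \<open>
  If \<open>x\<close> is not yet in the image, then the hypothesis on squares provides \<open>p\<close> with
  \<open>x\<^sup>2 = \<phi>(p)\<^sup>2\<close>, and \<open>x \<phi>(p)\<^sup>-\<^sup>1\<close> is an involution outside the image that can be adjoined.  Finiteness
  ends the process.
\<close>

lemma split_off_involutions:
  fixes P :: "'p monoid" and G :: "'g monoid"
  assumes G: "comm_group G" "finite (carrier G)" and P: "group P"
    and \<phi>: "\<phi> \<in> hom P G" "inj_on \<phi> (carrier P)"
    and sq: "\<And>x. x \<in> carrier G \<Longrightarrow> \<exists>p\<in>carrier P. x \<otimes>\<^bsub>G\<^esub> x = \<phi> p \<otimes>\<^bsub>G\<^esub> \<phi> p"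
  shows "\<exists>a. G \<cong> P \<times>\<times> group_power (integer_mod_group 2) a"
proof (rule ccontr)
  assume none: "\<not> ?thesis"
  interpret G: comm_group G by fact
  let ?Z = "integer_mod_group 2"
  have grpQ: "group (P \<times>\<times> group_power ?Z a)" for a
    by (intro DirProd_group group_group_power assms) simp
  have "\<exists>h. h \<in> hom (P \<times>\<times> group_power ?Z a) G \<and> inj_on h (carrier (P \<times>\<times> group_power ?Z a)) \<and>
        \<phi> ` carrier P \<subseteq> h ` carrier (P \<times>\<times> group_power ?Z a)" for a
  proof (induction a)
    case 0
    have "(\<lambda>(p, f). \<phi> p) \<in> hom (P \<times>\<times> group_power ?Z 0) G"
      using \<phi>(1) by (auto simp: hom_def)
    moreover have "inj_on (\<lambda>(p, f). \<phi> p) (carrier (P \<times>\<times> group_power ?Z 0))"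
      using \<phi>(2) by (auto simp: inj_on_def)
    ultimately show ?case by (intro exI[of _ "\<lambda>(p, f). \<phi> p"]) auto
  next
    case (Suc a)
    let ?Q = "P \<times>\<times> group_power ?Z a"
    obtain h where h: "h \<in> hom ?Q G" "inj_on h (carrier ?Q)" "\<phi> ` carrier P \<subseteq> h ` carrier ?Q"
      using Suc.IH by blast
    interpret h: group_hom ?Q G h
      using h(1) grpQ by (simp add: group_hom_def group_hom_axioms_def)
    have "h ` carrier ?Q \<noteq> carrier G"
    proof
      assume "h ` carrier ?Q = carrier G"
      then have "h \<in> iso ?Q G" using h by (simp add: iso_def bij_betw_def)
      then have "G \<cong> ?Q" using group.iso_sym[OF grpQ] is_isoI by blast
      then show False using none by blast
    qed
    moreover have "h ` carrier ?Q \<subseteq> carrier G" using h.hom_closed by blast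
    ultimately obtain x where x: "x \<in> carrier G" "x \<notin> h ` carrier ?Q" by blast
    obtain p where p: "p \<in> carrier P" "x \<otimes>\<^bsub>G\<^esub> x = \<phi> p \<otimes>\<^bsub>G\<^esub> \<phi> p" using sq[OF x(1)] by blast
    have \<phi>p: "\<phi> p \<in> carrier G" using \<phi>(1) p(1) by (auto simp: hom_def)
    have "\<phi> p \<in> h ` carrier ?Q" by (rule subsetD[OF h(3) imageI[OF p(1)]])
    then obtain q where q: "q \<in> carrier ?Q" "\<phi> p = h q" by (rule imageE)
    let ?w = "x \<otimes>\<^bsub>G\<^esub> inv\<^bsub>G\<^esub> \<phi> p"
    have w: "?w \<in> carrier G" using x(1) \<phi>p by simp
    have "?w \<otimes>\<^bsub>G\<^esub> ?w = (x \<otimes>\<^bsub>G\<^esub> x) \<otimes>\<^bsub>G\<^esub> (inv\<^bsub>G\<^esub> \<phi> p \<otimes>\<^bsub>G\<^esub> inv\<^bsub>G\<^esub> \<phi> p)"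
      using x(1) \<phi>p by (simp add: G.m_ac)
    also have "\<dots> = \<one>\<^bsub>G\<^esub>" unfolding p(2) using \<phi>p
      by (metis G.inv_mult_group G.m_closed G.r_inv)
    finally have ww: "?w \<otimes>\<^bsub>G\<^esub> ?w = \<one>\<^bsub>G\<^esub>" .
    have "?w \<notin> h ` carrier ?Q"
    proof
      assume "?w \<in> h ` carrier ?Q"
      then obtain r where r: "r \<in> carrier ?Q" "?w = h r" by blast
      have "x = ?w \<otimes>\<^bsub>G\<^esub> \<phi> p" using x(1) \<phi>p by (simp add: G.m_assoc)
      also have "\<dots> = h r \<otimes>\<^bsub>G\<^esub> h q" by (simp only: r(2)[symmetric] q(2)[symmetric])
      also have "\<dots> = h (r \<otimes>\<^bsub>?Q\<^esub> q)" by (rule h.hom_mult[symmetric, OF r(1) q(1)])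
      finally show False
        using x(2) monoid.m_closed[OF group.is_monoid[OF grpQ] r(1) q(1)] by blast
    qed
    note ext = adjoin_involution[OF G(1) P h(1,2) w this ww]
    show ?case by (rule exI, intro conjI, rule ext(1), rule ext(2), rule subset_trans[OF h(3) ext(3)])
  qed
  note all = this
  have *: "\<exists>h. h \<in> hom (P \<times>\<times> group_power ?Z a) G \<and> inj_on h (carrier (P \<times>\<times> group_power ?Z a))" for a
    using all[of a] by (elim exE conjE) (intro exI conjI)
  have "a < card (carrier G)" for a :: nat
  proof -
    obtain h where h: "h \<in> hom (P \<times>\<times> group_power ?Z a) G" "inj_on h (carrier (P \<times>\<times> group_power ?Z a))"
      using * by blast
    let ?B = "{\<one>\<^bsub>P\<^esub>} \<times> carrier (group_power ?Z a)"
    have sub: "?B \<subseteq> carrier (P \<times>\<times> group_power ?Z a)"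
      using monoid.one_closed[OF group.is_monoid[OF P]] by auto
    have "a < 2 ^ a" by simp
    also have "2 ^ a = card ?B"
      by (simp add: card_PiE card_cartesian_product carrier_integer_mod_group)
    also have "\<dots> \<le> card (carrier G)"
    proof (rule card_inj_on_le[where f = h])
      show "inj_on h ?B" using h(2) sub inj_on_subset by blast
      show "h ` ?B \<subseteq> carrier G" using h(1) sub by (auto simp: hom_def simp del: carrier_DirProd)
    qed (rule G(2))
    finally show ?thesis .
  qed
  then show False by blast
qed

section \<open>The form, the lattice and its dual\<close>

lemma bform_add_left: "bform S (x + x') y = bform S x y + bform S x' y"
  by (simp add: bform_def algebra_simps sum.distrib)

lemma bform_add_right: "bform S x (y + y') = bform S x y + bform S x y'"
  by (simp add: bform_def algebra_simps sum.distrib)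

lemma bform_scale_left: "bform S (c *s x) y = c * bform S x y"
  by (simp add: bform_def sum_distrib_left mult_ac)

lemma bform_scale_right: "bform S x (c *s y) = c * bform S x y"
  by (simp add: bform_def sum_distrib_left mult_ac)

lemma bform_minus_left: "bform S (- x) y = - bform S x y"
  by (simp add: bform_def sum_negf)

lemma bform_minus_right: "bform S x (- y) = - bform S x y"
  by (simp add: bform_def sum_negf)

lemma bform_diff_left: "bform S (x - x') y = bform S x y - bform S x' y"
  by (simp add: bform_def algebra_simps sum_subtractf)

lemma bform_diff_right: "bform S x (y - y') = bform S x y - bform S x y'"
  by (simp add: bform_def algebra_simps sum_subtractf)

lemma bform_zero_left [simp]: "bform S 0 y = 0"
  by (simp add: bform_def)

lemma bform_zero_right [simp]: "bform S x 0 = 0"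
  by (simp add: bform_def)

lemmas bform_simps = bform_add_left bform_add_right bform_scale_left bform_scale_right
  bform_minus_left bform_minus_right bform_diff_left bform_diff_right

lemma bform_axis: "bform S (axis i 1) (axis j 1 :: 'a::comm_ring_1 ^ 'n) = of_int (S $ i $ j)"
proof -
  have "bform S (axis i 1) (axis j 1 :: 'a ^ 'n) =
      (\<Sum>k\<in>UNIV. \<Sum>l\<in>UNIV. if l = j then (if k = i then of_int (S $ k $ l) else 0) else 0)"
    unfolding bform_def by (intro sum.cong refl) (auto simp: axis_def)
  then show ?thesis by (simp add: sum.delta)
qed

lemma bform_commute:
  assumes "even_lattice S"
  shows "bform S x y = bform S y x"
proof -
  have "S $ i $ j = S $ j $ i" for i j
    using assms bform_axis[of S i j, where 'a = int] bform_axis[of S j i, where 'a = int]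
    unfolding even_lattice_def by simp
  then show ?thesis
    unfolding bform_def by (subst sum.swap) (simp add: mult_ac)
qed

definition of_int_vec :: "int ^ 'n \<Rightarrow> 'a::ring_1 ^ 'n" where
  "of_int_vec z = (\<chi> i. of_int (z $ i))"

lemma int_vecs_eq_range: "int_vecs = range of_int_vec"
proof
  show "int_vecs \<subseteq> range (of_int_vec :: int ^ 'n \<Rightarrow> rat ^ 'n)"
  proof
    fix x :: "rat ^ 'n" assume "x \<in> int_vecs"
    then have "\<forall>i. \<exists>k. x $ i = of_int k" by (auto simp: int_vecs_def Ints_def)
    then obtain k where "\<And>i. x $ i = of_int (k i)" by metis
    then have "x = of_int_vec (\<chi> i. k i)" by (simp add: of_int_vec_def vec_eq_iff)
    then show "x \<in> range of_int_vec" by blast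
  qed
qed (auto simp: int_vecs_def of_int_vec_def)

lemma bform_of_int_vec: "bform S (of_int_vec x) (of_int_vec y) = of_int (bform S x y)"
  by (simp add: bform_def of_int_vec_def)

lemma int_vecs_zero [simp]: "0 \<in> int_vecs"
  and int_vecs_add: "x \<in> int_vecs \<Longrightarrow> y \<in> int_vecs \<Longrightarrow> x + y \<in> int_vecs"
  and int_vecs_minus: "x \<in> int_vecs \<Longrightarrow> - x \<in> int_vecs"
  and int_vecs_diff: "x \<in> int_vecs \<Longrightarrow> y \<in> int_vecs \<Longrightarrow> x - y \<in> int_vecs"
  and int_vecs_scale: "c \<in> \<int> \<Longrightarrow> x \<in> int_vecs \<Longrightarrow> c *s x \<in> int_vecs"
  by (auto simp: int_vecs_def)

lemma bform_int_vecs: "x \<in> int_vecs \<Longrightarrow> y \<in> int_vecs \<Longrightarrow> bform S x y \<in> \<int>"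
  by (auto simp: int_vecs_eq_range bform_of_int_vec)

lemma bform_int_vecs_even:
  assumes "even_lattice S" "x \<in> int_vecs"
  shows "bform S x x / 2 \<in> \<int>"
proof -
  obtain z where z: "x = of_int_vec z" using assms(2) by (auto simp: int_vecs_eq_range)
  have "even (bform S z z)" using assms(1) by (simp add: even_lattice_def)
  then obtain k where "bform S z z = 2 * k" by (rule evenE)
  then have "bform S x x / 2 = of_int k" by (simp add: z bform_of_int_vec)
  then show ?thesis by simp
qed

lemma dual_lattice_add: "x \<in> dual_lattice S \<Longrightarrow> y \<in> dual_lattice S \<Longrightarrow> x + y \<in> dual_lattice S"
  and dual_lattice_minus: "x \<in> dual_lattice S \<Longrightarrow> - x \<in> dual_lattice S"
  and dual_lattice_diff: "x \<in> dual_lattice S \<Longrightarrow> y \<in> dual_lattice S \<Longrightarrow> x - y \<in> dual_lattice S"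
  and dual_lattice_scale: "c \<in> \<int> \<Longrightarrow> x \<in> dual_lattice S \<Longrightarrow> c *s x \<in> dual_lattice S"
  and dual_lattice_zero [simp]: "0 \<in> dual_lattice S"
  by (auto simp: dual_lattice_def bform_simps)

lemma int_vecs_subset_dual_lattice: "int_vecs \<subseteq> dual_lattice S"
  by (auto simp: dual_lattice_def bform_int_vecs)

lemma bform_dual_int: "x \<in> dual_lattice S \<Longrightarrow> y \<in> int_vecs \<Longrightarrow> bform S x y \<in> \<int>"
  by (simp add: dual_lattice_def)

lemma bform_int_dual:
  "even_lattice S \<Longrightarrow> x \<in> int_vecs \<Longrightarrow> y \<in> dual_lattice S \<Longrightarrow> bform S x y \<in> \<int>"
  using bform_dual_int bform_commute by metis

lemma clear_denominators:
  fixes x :: "rat ^ 'n"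
  obtains k :: int where "k > 0" "of_int k *s x \<in> int_vecs"
proof
  let ?d = "\<lambda>i. snd (quotient_of (x $ i))"
  show "(\<Prod>i\<in>UNIV. ?d i) > 0" by (intro prod_pos ballI quotient_of_denom_pos')
  show "of_int (\<Prod>i\<in>UNIV. ?d i) *s x \<in> int_vecs"
    unfolding int_vecs_def
  proof (intro CollectI allI)
    fix i
    have "x $ i = of_int (fst (quotient_of (x $ i))) / of_int (?d i)"
      by (simp add: quotient_of_div)
    then have "of_int (?d i) * x $ i = of_int (fst (quotient_of (x $ i)))"
      using quotient_of_denom_pos'[of "x $ i"] by (simp add: field_simps)
    moreover have "(\<Prod>i\<in>UNIV. ?d i) = (\<Prod>i\<in>UNIV - {i}. ?d i) * ?d i"
      by (simp add: prod.remove[of UNIV i])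
    ultimately have "(of_int (\<Prod>i\<in>UNIV. ?d i) *s x) $ i =
        of_int ((\<Prod>i\<in>UNIV - {i}. ?d i) * fst (quotient_of (x $ i)))"
      by (simp add: mult.assoc)
    then show "(of_int (\<Prod>i\<in>UNIV. ?d i) *s x) $ i \<in> \<int>" by (metis Ints_of_int)
  qed
qed

text \<open>
  Over \<open>\<rat>\<close> the Gram matrix is injective because denominators can be cleared; the columns of its
  inverse form the basis of the dual lattice that is dual to the standard basis.
\<close>

lemma dual_basis:
  fixes S :: "int ^ 'n ^ 'n"
  assumes "even_lattice S"
  shows "\<exists>d. (\<forall>i. d i \<in> dual_lattice S) \<and> (\<forall>x i. bform S x (d i) = x $ i)"
proof -
  let ?R = "(\<chi> i j. of_int (S $ i $ j)) :: rat ^ 'n ^ 'n"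
  have bf: "bform S x y = (\<Sum>i\<in>UNIV. x $ i * (?R *v y) $ i)" for x y
    by (simp add: bform_def matrix_vector_mult_def sum_distrib_left mult_ac)
  have "y = 0" if "?R *v y = 0" for y
  proof -
    obtain k where k: "k > 0" "of_int k *s y \<in> int_vecs" by (rule clear_denominators)
    then obtain z where z: "of_int k *s y = of_int_vec z" by (auto simp: int_vecs_eq_range)
    have "bform S w z = 0" for w
    proof -
      have "of_int (bform S w z) = bform S (of_int_vec w) (of_int k *s y)"
        by (simp add: z bform_of_int_vec)
      also have "\<dots> = 0" using that by (simp add: bform_scale_right bf)
      finally show ?thesis by simp
    qed
    then have "z = 0" using assms unfolding even_lattice_def by metis
    then have "of_int k *s y = 0" using z by (simp add: of_int_vec_def vec_eq_iff)
    then show "y = 0" using k(1) by (simp add: vec_eq_iff)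
  qed
  then have "\<exists>B. B ** ?R = mat 1" by (simp add: matrix_left_invertible_ker)
  then obtain B where "?R ** B = mat 1" using matrix_left_right_inverse by blast
  then have B: "?R *v (B *v v) = v" for v by (simp add: matrix_vector_mul_assoc)
  have d: "bform S x (B *v axis i 1) = x $ i" for x i
  proof -
    have "bform S x (B *v axis i 1) = (\<Sum>j\<in>UNIV. if j = i then x $ j else 0)"
      unfolding bf B by (intro sum.cong) (auto simp: axis_def)
    then show ?thesis by simp
  qed
  moreover have "B *v axis i 1 \<in> dual_lattice S" for i
  proof -
    have "bform S (B *v axis i 1) y = y $ i" for y
      using d[of y i] bform_commute[OF assms, of y] by simp
    then show ?thesis by (simp add: dual_lattice_def int_vecs_def)
  qed
  ultimately show ?thesis by (intro exI[of _ "\<lambda>i. B *v axis i 1"]) simp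
qed

text \<open>
  The coordinates of \<open>x\<close> are its pairings with the dual basis, so integrality of these pairings is
  integrality of \<open>x\<close>.
\<close>

lemma double_dual:
  assumes "even_lattice S" "\<And>y. y \<in> dual_lattice S \<Longrightarrow> bform S x y \<in> \<int>"
  shows "x \<in> int_vecs"
proof -
  obtain d where d: "\<And>i. d i \<in> dual_lattice S" "\<And>x i. bform S x (d i) = x $ i"
    using dual_basis[OF assms(1)] by auto
  show ?thesis using assms(2)[OF d(1)] by (auto simp: int_vecs_def d(2))
qed

lemma bform_nondegenerate:
  fixes x :: "rat ^ 'n"
  assumes "even_lattice S" "\<And>y. bform S x y = 0"
  shows "x = 0"
proof -
  obtain d where d: "\<And>i. d i \<in> dual_lattice S" "\<And>x i. bform S x (d i) = x $ i"
    using dual_basis[OF assms(1)] by auto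
  have "x $ i = 0" for i using assms(2)[of "d i"] by (simp add: d(2))
  then show ?thesis by (simp add: vec_eq_iff)
qed

definition primitive_vec :: "rat ^ 'n \<Rightarrow> bool" where
  "primitive_vec e \<longleftrightarrow> e \<in> int_vecs \<and> e \<noteq> 0 \<and> (\<forall>c. c *s e \<in> int_vecs \<longrightarrow> c \<in> \<int>)"

text \<open>
  The values of \<open>(e, \<cdot>)\<close> on the dual lattice form a nonzero ideal \<open>d\<int>\<close>; then \<open>e / d\<close> lies in the
  double dual, which is the lattice, and primitivity forces \<open>d = 1\<close>.
\<close>

lemma primitive_vec_dual_partner:
  assumes S: "even_lattice S" and e: "primitive_vec e"
  obtains y where "y \<in> dual_lattice S" "bform S e y = 1"
proof -
  have eL: "e \<in> int_vecs" "e \<noteq> 0" and prim: "\<And>c. c *s e \<in> int_vecs \<Longrightarrow> c \<in> \<int>"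
    using e by (auto simp: primitive_vec_def)
  let ?P = "\<lambda>n::nat. n > 0 \<and> (\<exists>y\<in>dual_lattice S. bform S e y = of_nat n)"
  obtain i where i: "e $ i \<noteq> 0" using eL(2) by (auto simp: vec_eq_iff)
  obtain d0 where d0: "d0 \<in> dual_lattice S" "bform S e d0 = e $ i"
    using dual_basis[OF S] by auto
  obtain k where k: "e $ i = of_int k" using eL(1) by (auto simp: int_vecs_def Ints_def)
  have ex: "?P (nat \<bar>k\<bar>)"
  proof (cases "k > 0")
    case True
    then have "bform S e d0 = of_nat (nat \<bar>k\<bar>)" "nat \<bar>k\<bar> > 0" using d0 k by auto
    then show ?thesis using d0(1) by blast
  next
    case False
    then have "bform S e (- d0) = of_nat (nat \<bar>k\<bar>)" "nat \<bar>k\<bar> > 0"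
      using d0 k i by (auto simp: bform_minus_right)
    then show ?thesis using dual_lattice_minus[OF d0(1)] by blast
  qed
  define n where "n = (LEAST n. ?P n)"
  have n: "?P n" unfolding n_def by (rule LeastI[of ?P, OF ex])
  have min: "n \<le> m" if "?P m" for m unfolding n_def by (rule Least_le[of ?P, OF that])
  obtain y where y: "y \<in> dual_lattice S" "bform S e y = of_nat n" using n by blast
  have "(1 / of_nat n) *s e \<in> int_vecs"
  proof (rule double_dual[OF S])
    fix x assume x: "x \<in> dual_lattice S"
    obtain a where a: "bform S e x = of_int a" using bform_int_dual[OF S eL(1) x] by (auto simp: Ints_def)
    let ?q = "a div int n" and ?r = "a mod int n"
    have "bform S e (x - of_int ?q *s y) = of_int (a - ?q * int n)"
      by (simp add: bform_simps a y(2))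
    also have "a - ?q * int n = ?r" by (simp add: minus_div_mult_eq_mod)
    finally have r: "bform S e (x - of_int ?q *s y) = of_int ?r" .
    have "x - of_int ?q *s y \<in> dual_lattice S"
      using x y by (intro dual_lattice_diff dual_lattice_scale) auto
    moreover have rb: "0 \<le> ?r" "?r < int n" using n by auto
    then have "of_int ?r = (of_nat (nat ?r) :: rat)" by simp
    ultimately have "?r > 0 \<Longrightarrow> ?P (nat ?r)" using r by auto
    then have "?r = 0" using min[of "nat ?r"] rb by linarith
    then have "a = int n * ?q" using mult_div_mod_eq[of "int n" a] by linarith
    then have "of_int a = (of_nat n * of_int ?q :: rat)" by (metis of_int_mult of_int_of_nat_eq)
    then have "bform S ((1 / of_nat n) *s e) x = of_int ?q"
      using n by (simp add: bform_scale_left a)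
    then show "bform S ((1 / of_nat n) *s e) x \<in> \<int>" by simp
  qed
  then have "1 / of_nat n \<in> (\<int> :: rat set)" by (rule prim)
  then obtain m where "1 / of_nat n = (of_int m :: rat)" by (auto simp: Ints_def)
  then have "(1::rat) = of_int m * of_nat n" using n by (simp add: field_simps)
  then have "(of_int 1 :: rat) = of_int (m * int n)" by simp
  then have "1 = m * int n" by (simp only: of_int_eq_iff)
  then have "n = 1" using n by (metis abs_of_nat dvd_triv_right int_ops(2) nat_int of_nat_eq_iff zdvd1_eq)
  then show thesis using y that by simp
qed

section \<open>Unipotent isometries acting as minus one on the discriminant group\<close>

lemma half_integers_add:
  fixes a b :: rat
  assumes "2 * a \<in> \<int>" "2 * b \<in> \<int>" "a \<notin> \<int>" "b \<notin> \<int>"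
  shows "a + b \<in> \<int>" "a - b \<in> \<int>"
proof -
  obtain m n where m: "2 * a = of_int m" and n: "2 * b = of_int n"
    using assms by (auto simp: Ints_def)
  have odd_m: "odd m"
  proof
    assume "even m"
    then obtain k where "m = 2 * k" by (elim evenE)
    then have "a = of_int k" using m by simp
    then show False using assms(3) by simp
  qed
  have odd_n: "odd n"
  proof
    assume "even n"
    then obtain k where "n = 2 * k" by (elim evenE)
    then have "b = of_int k" using n by simp
    then show False using assms(4) by simp
  qed
  obtain k where "m + n = 2 * k" using odd_m odd_n by (metis odd_even_add evenE)
  then have "2 * a + 2 * b = 2 * of_int k"
    unfolding m n by (simp flip: of_int_add)
  then have "2 * (a + b) = 2 * of_int k" by (simp only: distrib_left)
  then have "a + b = of_int k" by (metis mult_left_cancel zero_neq_numeral)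
  then show "a + b \<in> \<int>" by simp
  obtain k where "m - n = 2 * k" using odd_m odd_n by (metis even_diff odd_even_add evenE)
  then have "2 * a - 2 * b = 2 * of_int k"
    unfolding m n by (simp flip: of_int_diff)
  then have "2 * (a - b) = 2 * of_int k" by (simp only: right_diff_distrib)
  then have "a - b = of_int k" by (metis mult_left_cancel zero_neq_numeral)
  then show "a - b \<in> \<int>" by simp
qed

text \<open>
  The two alternatives say that \<open>2 A\<close> is cyclic of order 4, respectively a Klein four-group, where
  \<open>A = L\<^sup>\<or>/L\<close>.  They arise from \<open>(u, u)\<close> being a proper half-integer, respectively an integer, for
  \<open>u = g y - y\<close> with \<open>(e, y) = 1\<close>.
\<close>

lemma unipotent_acting_as_minus_one:
  fixes g :: "rat ^ 'n ^ 'n"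
  assumes S: "even_lattice S" and e: "primitive_vec e" and ee: "bform S e e = 0"
    and isom: "\<And>x y. bform S (g *v x) (g *v y) = bform S x y"
    and ge: "g *v e = e"
    and unipotent: "\<forall>x. bform S e x = 0 \<longrightarrow> (\<exists>c. g *v x - x = c *s e)"
    and integral: "\<forall>x\<in>int_vecs. g *v x \<in> int_vecs"
    and minus_one: "\<forall>x\<in>dual_lattice S. g *v x + x \<in> int_vecs"
    and nontriv: "\<exists>x\<in>dual_lattice S. 2 *s x \<notin> int_vecs"
  shows "(\<exists>y\<in>dual_lattice S. 8 *s y \<in> int_vecs \<and> 4 *s y \<notin> int_vecs \<and>
            (\<forall>x\<in>dual_lattice S. \<exists>k. 2 *s x - (2 * of_int k) *s y \<in> int_vecs)) \<or>
         (\<exists>y\<in>dual_lattice S. \<exists>z\<in>dual_lattice S. 4 *s y \<in> int_vecs \<and> 4 *s z \<in> int_vecs \<and>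
            2 *s y \<notin> int_vecs \<and> 2 *s z \<notin> int_vecs \<and> 2 *s y + 2 *s z \<notin> int_vecs \<and>
            (\<forall>x\<in>dual_lattice S. \<exists>j k. 2 *s x - (2 * of_int j) *s y - (2 * of_int k) *s z \<in> int_vecs))"
    (is "?cyclic \<or> ?pair")
proof -
  note comm = bform_commute[OF S] and perp = unipotent[rule_format]
    and gL = integral[rule_format] and neg = minus_one[rule_format]
  have eL: "e \<in> int_vecs" and prim: "\<And>c. c *s e \<in> int_vecs \<Longrightarrow> c \<in> \<int>"
    using e by (auto simp: primitive_vec_def)
  have Le: "c \<in> \<int> \<Longrightarrow> c *s e \<in> int_vecs" for c using eL int_vecs_scale by blast
  obtain y where y: "y \<in> dual_lattice S" "bform S e y = 1"
    by (rule primitive_vec_dual_partner[OF S e])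
  define u where "u = g *v y - y"
  define N where "N = bform S u u"
  have gy: "g *v y = y + u" by (simp add: u_def)
  have eu: "bform S e u = 0"
    using isom[of e y] by (simp add: u_def bform_diff_right ge)
  have gx: "g *v x = x - bform S x u *s e" if x: "bform S e x = 0" for x
  proof -
    obtain c where c: "g *v x = x + c *s e" using perp[OF x] by (metis add_diff_cancel_left' diff_add_cancel add.commute)
    have "bform S x y = bform S (x + c *s e) (y + u)" using isom[of x y] by (simp add: c gy)
    then have "c = - bform S x u" using y(2) eu by (simp add: bform_simps)
    then show ?thesis by (simp add: c vec_eq_iff)
  qed
  have gu: "g *v u = u - N *s e" using gx[OF eu] by (simp add: N_def)
  have yu: "2 * bform S y u + N = 0"
    using isom[of y y] by (simp add: gy bform_simps N_def comm[of u y])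
  have y2u: "2 *s y + u \<in> int_vecs"
  proof -
    have "g *v y + y = 2 *s y + u" by (simp add: gy vec_eq_iff)
    then show ?thesis using neg[OF y(1)] by simp
  qed
  have g2: "g *v (g *v x) - x \<in> int_vecs" if x: "x \<in> dual_lattice S" for x
  proof -
    have "g *v x + x \<in> dual_lattice S" using neg[OF x] int_vecs_subset_dual_lattice by blast
    then have "(g *v x + x) - x \<in> dual_lattice S" using x dual_lattice_diff by blast
    then have "g *v x \<in> dual_lattice S" by simp
    from int_vecs_diff[OF neg[OF this] neg[OF x]] show ?thesis by simp
  qed
  \<comment> \<open>Since \<open>g\<close> is \<open>-1\<close> modulo the lattice, \<open>g\<^sup>2\<close> is the identity modulo the lattice; comparing with its
    explicit unipotent form gives the integrality of \<open>2 (x, u)\<close>, of \<open>4 y + N e\<close> and of \<open>2 N\<close>.\<close>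
  have half: "2 * bform S x u \<in> \<int>" if x: "x \<in> dual_lattice S" "bform S e x = 0" for x
  proof -
    have "g *v (g *v x) - x = (- 2 * bform S x u) *s e"
      by (simp add: gx[OF x(2)] matrix_vector_mult_diff_distrib vec.scale ge vec_eq_iff algebra_simps)
    then have "- 2 * bform S x u \<in> \<int>" using g2[OF x(1)] prim by metis
    then show ?thesis using Ints_minus[of "- 2 * bform S x u"] by simp
  qed
  have y4: "4 *s y + N *s e \<in> int_vecs"
  proof -
    have "4 *s y + N *s e = ((2 *s y + u) + (2 *s y + u)) - (g *v (g *v y) - y)"
      by (simp add: gy gu matrix_vector_right_distrib vec_eq_iff algebra_simps)
    then show ?thesis using int_vecs_diff[OF int_vecs_add[OF y2u y2u] g2[OF y(1)]] by simp
  qed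
  have N2: "2 * N \<in> \<int>"
  proof -
    let ?l = "2 *s y + u"
    have l: "g *v (g *v ?l) - ?l \<in> int_vecs" using gL y2u by (intro int_vecs_diff) auto
    have "(- 2 * N) *s e = (g *v (g *v ?l) - ?l) - ((g *v (g *v y) - y) + (g *v (g *v y) - y))"
      by (simp add: gy gu ge matrix_vector_right_distrib matrix_vector_mult_diff_distrib vec.scale
          vec_eq_iff algebra_simps)
    then have "(- 2 * N) *s e \<in> int_vecs"
      using int_vecs_diff[OF l int_vecs_add[OF g2[OF y(1)] g2[OF y(1)]]] by simp
    then have "- 2 * N \<in> \<int>" by (rule prim)
    then show ?thesis using Ints_minus[of "- 2 * N"] by simp
  qed
  have ey: "bform S e x \<in> \<int>" if "x \<in> dual_lattice S" for x
    using bform_int_dual[OF S eL that] .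
  \<comment> \<open>\<open>q\<close> is the projection to the orthogonal complement of \<open>e\<close> along \<open>y\<close>.\<close>
  define q where "q x = x - bform S e x *s y" for x
  have q: "q x \<in> dual_lattice S" "bform S e (q x) = 0" if "x \<in> dual_lattice S" for x
    using that y ey[OF that]
    by (auto simp: q_def bform_simps intro!: dual_lattice_diff dual_lattice_scale)
  have neg_perp: "2 *s x - bform S x u *s e \<in> int_vecs"
    if x: "x \<in> dual_lattice S" "bform S e x = 0" for x
  proof -
    have "g *v x + x = 2 *s x - bform S x u *s e" by (simp add: gx[OF x(2)] vec_eq_iff)
    then show ?thesis using neg[OF x(1)] by simp
  qed
  have int_perp: "2 *s x \<in> int_vecs"
    if x: "x \<in> dual_lattice S" "bform S e x = 0" "bform S x u \<in> \<int>" for x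
    using int_vecs_add[OF neg_perp[OF x(1,2)] Le[OF x(3)]] by simp
  show ?thesis
  proof (cases "N \<in> \<int>")
    case False
    have "8 *s y = (4 *s y + N *s e) + (4 *s y + N *s e) - (2 * N) *s e"
      by (simp add: vec_eq_iff)
    then have 8: "8 *s y \<in> int_vecs"
      using int_vecs_diff[OF int_vecs_add[OF y4 y4] Le[OF N2]] by simp
    have 4: "4 *s y \<notin> int_vecs"
    proof
      assume "4 *s y \<in> int_vecs"
      then have "N *s e \<in> int_vecs" using int_vecs_diff[OF y4] by force
      then show False using prim False by blast
    qed
    have "\<exists>k. 2 *s x - (2 * of_int k) *s y \<in> int_vecs" if x: "x \<in> dual_lattice S" for x
    proof -
      obtain a where a: "bform S e x = of_int a" using ey[OF x] by (auto simp: Ints_def)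
      show ?thesis
      proof (cases "bform S (q x) u \<in> \<int>")
        case True
        have "2 *s q x = 2 *s x - (2 * of_int a) *s y"
          by (simp add: q_def a vec_eq_iff algebra_simps)
        then show ?thesis using int_perp[OF q[OF x] True] by metis
      next
        case F: False
        \<comment> \<open>Here \<open>2 q(x)\<close> and \<open>4 y\<close> are both congruent to \<open>e/2\<close>.\<close>
        have "bform S (q x) u + N \<in> \<int>"
          using half_integers_add(1)[OF half[OF q[OF x]] N2 F False] .
        from int_vecs_diff[OF int_vecs_add[OF neg_perp[OF q[OF x]] Le[OF this]] y4]
        have "2 *s q x - 4 *s y \<in> int_vecs" by (simp add: vec_eq_iff algebra_simps)
        moreover have "2 *s q x - 4 *s y = 2 *s x - (2 * of_int (a + 2)) *s y"
          by (simp add: q_def a vec_eq_iff algebra_simps)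
        ultimately show ?thesis by metis
      qed
    qed
    then have ?cyclic using y(1) 8 4 by blast
    then show ?thesis ..
  next
    case N: True
    have "4 *s y = (4 *s y + N *s e) - N *s e" by simp
    then have 4: "4 *s y \<in> int_vecs" using int_vecs_diff[OF y4 Le[OF N]] by simp
    have u_iff: "u \<in> int_vecs" if "2 *s y \<in> int_vecs"
      using int_vecs_diff[OF y2u that] by simp
    \<comment> \<open>Otherwise \<open>u\<close> would lie in the double dual up to a multiple of \<open>e\<close>; evenness of the lattice
      makes that multiple integral, and \<open>g\<close> would act trivially on the discriminant group.\<close>
    have "\<exists>z\<in>dual_lattice S. bform S e z = 0 \<and> bform S z u \<notin> \<int>"
    proof (rule ccontr)
      assume "\<not> ?thesis"
      then have all: "\<And>z. z \<in> dual_lattice S \<Longrightarrow> bform S e z = 0 \<Longrightarrow> bform S z u \<in> \<int>" by blast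
      let ?w = "u - bform S y u *s e"
      have w: "?w \<in> int_vecs"
      proof (rule double_dual[OF S])
        fix x assume x: "x \<in> dual_lattice S"
        have "bform S ?w x = bform S (q x) u"
          by (simp add: q_def bform_simps comm[of u x])
        then show "bform S ?w x \<in> \<int>" using all[OF q[OF x]] by simp
      qed
      have "bform S ?w ?w = N" by (simp add: bform_simps N_def eu ee comm[of u e])
      then have "N / 2 \<in> \<int>" using bform_int_vecs_even[OF S w] by simp
      moreover have "bform S y u = - (N / 2)" using yu by linarith
      ultimately have "bform S y u \<in> \<int>" by simp
      then have "u \<in> int_vecs" using int_vecs_add[OF w Le[of "bform S y u"]] by simp
      then have y2: "2 *s y \<in> int_vecs" using int_vecs_diff[OF y2u, of u] by simp
      have "2 *s x \<in> int_vecs" if x: "x \<in> dual_lattice S" for x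
      proof -
        have "2 *s x = 2 *s q x + bform S e x *s (2 *s y)"
          by (simp add: q_def vec_eq_iff algebra_simps)
        then show ?thesis
          using int_vecs_add[OF int_perp[OF q[OF x] all[OF q[OF x]]] int_vecs_scale[OF ey[OF x] y2]]
          by simp
      qed
      then show False using nontriv by blast
    qed
    \<comment> \<open>For this \<open>z\<close>, the class of \<open>2 z\<close> is that of \<open>e/2\<close>.\<close>
    then obtain z where z: "z \<in> dual_lattice S" "bform S e z = 0" "bform S z u \<notin> \<int>" by blast
    have z2: "2 *s z - bform S z u *s e \<in> int_vecs" by (rule neg_perp[OF z(1,2)])
    have "4 *s z = ((2 *s z - bform S z u *s e) + (2 *s z - bform S z u *s e)) + (2 * bform S z u) *s e"
      by (simp add: vec_eq_iff)
    then have z4: "4 *s z \<in> int_vecs"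
      using int_vecs_add[OF int_vecs_add[OF z2 z2] Le[OF half[OF z(1,2)]]] by simp
    have nz: "2 *s z \<notin> int_vecs"
    proof
      assume "2 *s z \<in> int_vecs"
      from int_vecs_diff[OF this z2] have "bform S z u *s e \<in> int_vecs" by simp
      then show False using prim z(3) by blast
    qed
    have ny: "2 *s y \<notin> int_vecs"
      using u_iff bform_dual_int[OF z(1)] z(3) by blast
    have nyz: "2 *s y + 2 *s z \<notin> int_vecs"
    proof
      assume *: "2 *s y + 2 *s z \<in> int_vecs"
      have "u - bform S z u *s e = ((2 *s y + u) - (2 *s y + 2 *s z)) + (2 *s z - bform S z u *s e)"
        by simp
      then have "u - bform S z u *s e \<in> int_vecs"
        using int_vecs_add[OF int_vecs_diff[OF y2u *] z2] by simp
      from bform_dual_int[OF z(1) this] show False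
        using z(2,3) by (simp add: bform_simps comm[of z e])
    qed
    have "\<exists>j k. 2 *s x - (2 * of_int j) *s y - (2 * of_int k) *s z \<in> int_vecs"
      if x: "x \<in> dual_lattice S" for x
    proof -
      obtain a where a: "bform S e x = of_int a" using ey[OF x] by (auto simp: Ints_def)
      show ?thesis
      proof (cases "bform S (q x) u \<in> \<int>")
        case True
        have "2 *s q x = 2 *s x - (2 * of_int a) *s y - (2 * of_int 0) *s z"
          by (simp add: q_def a vec_eq_iff algebra_simps)
        then show ?thesis using int_perp[OF q[OF x] True] by metis
      next
        case False
        have "bform S (q x) u - bform S z u \<in> \<int>"
          using half_integers_add(2)[OF half[OF q[OF x]] half[OF z(1,2)] False z(3)] .
        from int_vecs_add[OF int_vecs_diff[OF neg_perp[OF q[OF x]] z2] Le[OF this]]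
        have "2 *s q x - 2 *s z \<in> int_vecs" by (simp add: vec_eq_iff algebra_simps)
        moreover have "2 *s q x - 2 *s z = 2 *s x - (2 * of_int a) *s y - (2 * of_int 1) *s z"
          by (simp add: q_def a vec_eq_iff algebra_simps)
        ultimately show ?thesis by metis
      qed
    qed
    then have ?pair using y(1) z(1) 4 z4 ny nz nyz by blast
    then show ?thesis ..
  qed
qed

section \<open>The discriminant group\<close>

definition lattice_coset :: "rat ^ 'n \<Rightarrow> (rat ^ 'n) set" where
  "lattice_coset x = (\<lambda>l. l + x) ` int_vecs"

lemma lattice_coset_eq_iff: "lattice_coset x = lattice_coset y \<longleftrightarrow> x - y \<in> int_vecs"
proof
  assume "lattice_coset x = lattice_coset y"
  moreover have "x \<in> lattice_coset x" unfolding lattice_coset_def by (rule image_eqI[of _ _ 0]) auto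
  ultimately show "x - y \<in> int_vecs" by (auto simp: lattice_coset_def)
next
  have sub: "lattice_coset x \<subseteq> lattice_coset y" if "x - y \<in> int_vecs" for x y :: "rat ^ 'n"
  proof
    fix v assume "v \<in> lattice_coset x"
    then obtain l where l: "l \<in> int_vecs" "v = l + x" by (auto simp: lattice_coset_def)
    have "v = (l + (x - y)) + y" by (simp add: l)
    then show "v \<in> lattice_coset y" unfolding lattice_coset_def using int_vecs_add[OF l(1) that] by blast
  qed
  assume "x - y \<in> int_vecs"
  then show "lattice_coset x = lattice_coset y"
    using sub[of x y] sub[of y x] int_vecs_minus[of "x - y"] by auto
qed

lemma add_group_simps [simp]:
  "carrier (add_group A) = A" "x \<otimes>\<^bsub>add_group A\<^esub> y = x + y" "\<one>\<^bsub>add_group A\<^esub> = 0"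
  by (simp_all add: add_group_def)

lemma comm_group_add_group:
  assumes "0 \<in> A" "\<And>x y. x \<in> A \<Longrightarrow> y \<in> A \<Longrightarrow> x + y \<in> A" "\<And>x. x \<in> A \<Longrightarrow> - x \<in> A"
  shows "comm_group (add_group A)"
proof (rule comm_groupI)
  fix x assume "x \<in> carrier (add_group A)"
  then show "\<exists>y\<in>carrier (add_group A). y \<otimes>\<^bsub>add_group A\<^esub> x = \<one>\<^bsub>add_group A\<^esub>"
    using assms(3)[of x] by (intro bexI[of _ "- x"]) auto
qed (use assms in \<open>auto simp: algebra_simps\<close>)

lemma comm_group_dual_lattice: "comm_group (add_group (dual_lattice S))"
  by (rule comm_group_add_group) (auto intro: dual_lattice_add dual_lattice_minus)

lemma comm_group_int_vecs: "comm_group (add_group int_vecs)"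
  by (rule comm_group_add_group) (auto intro: int_vecs_add int_vecs_minus)

lemma subgroup_int_vecs: "subgroup int_vecs (add_group (dual_lattice S))"
proof -
  interpret G: comm_group "add_group (dual_lattice S)" by (rule comm_group_dual_lattice)
  show ?thesis
  proof (rule G.subgroupI)
    fix x :: "rat ^ 'a" assume x: "x \<in> int_vecs"
    have "inv\<^bsub>add_group (dual_lattice S)\<^esub> x = - x"
      using x int_vecs_subset_dual_lattice[of S] dual_lattice_minus[of x S]
      by (intro G.inv_equality) auto
    then show "inv\<^bsub>add_group (dual_lattice S)\<^esub> x \<in> int_vecs" using x int_vecs_minus by auto
  qed (use int_vecs_subset_dual_lattice[of S] in \<open>auto intro: int_vecs_add int_vecs_zero\<close>)
qed

lemma r_coset_int_vecs: "int_vecs #>\<^bsub>add_group A\<^esub> x = lattice_coset x"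
  by (auto simp: r_coset_def lattice_coset_def)

lemma comm_group_disc_group: "comm_group (disc_group S)"
  unfolding disc_group_def
  by (rule comm_group.abelian_FactGroup[OF comm_group_dual_lattice subgroup_int_vecs])

lemma carrier_disc_group: "carrier (disc_group S) = lattice_coset ` dual_lattice S"
  by (simp add: disc_group_def carrier_FactGroup r_coset_int_vecs)

lemma mult_disc_group:
  assumes "x \<in> dual_lattice S" "y \<in> dual_lattice S"
  shows "lattice_coset x \<otimes>\<^bsub>disc_group S\<^esub> lattice_coset y = lattice_coset (x + y)"
proof -
  have "int_vecs \<lhd> add_group (dual_lattice S)"
    using comm_group.normal_iff_subgroup[OF comm_group_dual_lattice] subgroup_int_vecs by blast
  from normal.rcos_sum[OF this, of x y] assms show ?thesis
    by (simp add: disc_group_def r_coset_int_vecs)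
qed

lemma one_disc_group: "\<one>\<^bsub>disc_group S\<^esub> = lattice_coset 0"
  by (simp add: disc_group_def lattice_coset_def)

text \<open>
  A bounded exponent suffices for finiteness: each class has a representative whose coordinates are
  among \<open>0, 1/c, \<dots>, (c - 1)/c\<close>.
\<close>

lemma finite_disc_group:
  assumes c: "c > 0" and "\<And>x. x \<in> dual_lattice S \<Longrightarrow> of_int c *s x \<in> int_vecs"
  shows "finite (carrier (disc_group S))"
proof -
  let ?F = "(\<lambda>k. of_int k / of_int c :: rat) ` {0..<c}"
  let ?B = "(\<lambda>f. \<chi> i. f i) ` (UNIV \<rightarrow>\<^sub>E ?F)"
  have "carrier (disc_group S) \<subseteq> lattice_coset ` ?B"
  proof (unfold carrier_disc_group, rule image_subsetI)
    fix x assume "x \<in> dual_lattice S"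
    then have "\<forall>i. \<exists>k. of_int c * x $ i = of_int k"
      using assms(2)[of x] by (auto simp: int_vecs_def Ints_def)
    then obtain k where k: "\<And>i. of_int c * x $ i = of_int (k i)" by metis
    let ?y = "(\<chi> i. of_int (k i mod c) / of_int c) :: rat ^ 'a"
    have "x $ i - ?y $ i = of_int (k i div c)" for i
    proof -
      have "of_int (k i) = (of_int (c * (k i div c) + k i mod c) :: rat)" by simp
      then have "of_int c * x $ i = of_int c * of_int (k i div c) + of_int (k i mod c)"
        unfolding k by (simp only: of_int_add of_int_mult)
      then show ?thesis using c by (simp add: field_simps)
    qed
    then have "x - ?y \<in> int_vecs" by (simp add: int_vecs_def)
    moreover have "?y \<in> ?B" using c by (intro image_eqI[OF refl]) auto
    ultimately show "lattice_coset x \<in> lattice_coset ` ?B"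
      using lattice_coset_eq_iff by blast
  qed
  moreover have "finite ?B" by (intro finite_imageI finite_PiE) auto
  ultimately show ?thesis using finite_surj by blast
qed

lemma two_elementary_disc_group_iff:
  "two_elementary (disc_group S) \<longleftrightarrow> (\<forall>x\<in>dual_lattice S. 2 *s x \<in> int_vecs)"
proof -
  have "x + x = 2 *s x" for x :: "rat ^ 'a" by (simp add: vec_eq_iff)
  then show ?thesis
    by (simp add: two_elementary_def carrier_disc_group mult_disc_group one_disc_group
        lattice_coset_eq_iff)
qed

text \<open>
  Every nonzero subgroup of \<open>\<int>/8\<close> contains 4, so \<open>y\<close> generates a cyclic subgroup of order 8 as soon
  as \<open>4 y\<close> does not vanish modulo the lattice.  The last hypothesis compares doubles with this subgroup.
\<close>

lemma disc_group_Z8: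
  assumes y: "y \<in> dual_lattice S" "8 *s y \<in> int_vecs" "4 *s y \<notin> int_vecs"
    and sq: "\<And>x. x \<in> dual_lattice S \<Longrightarrow> \<exists>k. 2 *s x - (2 * of_int k) *s y \<in> int_vecs"
  shows "\<exists>a. disc_group S \<cong> integer_mod_group 8 \<times>\<times> group_power (integer_mod_group 2) a"
proof (rule split_off_involutions)
  define R where "R j \<longleftrightarrow> of_int j *s y \<in> int_vecs" for j
  have R_mult: "R (m * j)" if "R j" for m j
    using int_vecs_scale[of "of_int m" "of_int j *s y"] that by (simp add: R_def)
  have R_add: "R (j + k)" if "R j" "R k" for j k
    using int_vecs_add[of "of_int j *s y" "of_int k *s y"] that
    by (simp add: R_def vector_sadd_rdistrib)
  have R8: "R (8 * m)" for m using R_mult[of 8 m] y(2) by (simp add: R_def mult.commute)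
  have R4: "\<not> R 4" using y(3) by (simp add: R_def)
  have R_mod: "R (j mod 8)" if "R j" for j
  proof -
    have "j mod 8 = j + 8 * (- (j div 8))" by (simp add: minus_mult_div_eq_mod)
    then show ?thesis using R_add[OF that R8] by metis
  qed
  have R_dvd: "8 dvd j" if "R j" for j
  proof -
    have *: "8 dvd j" if Rj: "R j" and dj: "4 dvd j" for j
    proof -
      obtain i where i: "j = 4 * i" using dj by (rule dvdE)
      have "odd i \<Longrightarrow> j mod 8 = 4" unfolding i by presburger
      then have "even i" using R_mod[OF Rj] R4 by metis
      then show ?thesis by (auto simp: i)
    qed
    have "8 dvd 4 * j" by (rule *[OF R_mult[OF that]]) simp
    then have "4 dvd 2 * j" by presburger
    then have "8 dvd 2 * j" by (rule *[OF R_mult[OF that]])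
    then have "4 dvd j" by presburger
    then show ?thesis by (rule *[OF that])
  qed
  define \<phi> where "\<phi> k = lattice_coset (of_int k *s y)" for k
  have \<phi>_eq: "\<phi> j = \<phi> k \<longleftrightarrow> R (j - k)" for j k
    by (simp add: \<phi>_def lattice_coset_eq_iff R_def vector_ssub_ldistrib vec.scale_left_diff_distrib)
  have ydual: "of_int k *s y \<in> dual_lattice S" for k using y(1) by (intro dual_lattice_scale) auto
  have \<phi>_mult: "\<phi> j \<otimes>\<^bsub>disc_group S\<^esub> \<phi> k = \<phi> (j + k)" for j k
    by (simp add: \<phi>_def mult_disc_group[OF ydual ydual] vector_sadd_rdistrib)
  have \<phi>_mod: "\<phi> (k mod 8) = \<phi> k" for k
  proof -
    have "k mod 8 - k = 8 * (- (k div 8))" by (simp add: minus_mult_div_eq_mod[symmetric])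
    then show ?thesis unfolding \<phi>_eq using R8 by metis
  qed
  show "comm_group (disc_group S)" by (rule comm_group_disc_group)
  show "finite (carrier (disc_group S))"
  proof (rule finite_disc_group)
    fix x assume x: "x \<in> dual_lattice S"
    obtain k where k: "2 *s x - (2 * of_int k) *s y \<in> int_vecs" using sq[OF x] by blast
    have "of_int 8 *s x = 4 *s (2 *s x - (2 * of_int k) *s y) + of_int k *s (8 *s y)"
      by (simp add: vec_eq_iff algebra_simps)
    also have "\<dots> \<in> int_vecs" using k y(2) by (simp only: int_vecs_add int_vecs_scale Ints_of_int Ints_numeral)
    finally show "of_int 8 *s x \<in> int_vecs" .
  qed simp
  show "group (integer_mod_group 8)" by simp
  show "\<phi> \<in> hom (integer_mod_group 8) (disc_group S)"
  proof (rule homI)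
    show "\<phi> k \<in> carrier (disc_group S)" for k by (simp add: carrier_disc_group \<phi>_def ydual)
    show "\<phi> (j \<otimes>\<^bsub>integer_mod_group 8\<^esub> k) = \<phi> j \<otimes>\<^bsub>disc_group S\<^esub> \<phi> k" for j k
      by (simp add: \<phi>_mult \<phi>_mod)
  qed
  show "inj_on \<phi> (carrier (integer_mod_group 8))"
  proof (rule inj_onI)
    fix j k assume jk: "j \<in> carrier (integer_mod_group 8)" "k \<in> carrier (integer_mod_group 8)" "\<phi> j = \<phi> k"
    then have "8 dvd j - k" using R_dvd \<phi>_eq by blast
    then show "j = k" using jk by (auto simp: carrier_integer_mod_group mod_eq_dvd_iff[symmetric])
  qed
  show "\<exists>p\<in>carrier (integer_mod_group 8). A \<otimes>\<^bsub>disc_group S\<^esub> A = \<phi> p \<otimes>\<^bsub>disc_group S\<^esub> \<phi> p"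
    if A: "A \<in> carrier (disc_group S)" for A
  proof -
  obtain x where x: "x \<in> dual_lattice S" "A = lattice_coset x" using A by (auto simp: carrier_disc_group)
  obtain k where k: "2 *s x - (2 * of_int k) *s y \<in> int_vecs" using sq[OF x(1)] by blast
  have "A \<otimes>\<^bsub>disc_group S\<^esub> A = lattice_coset (x + x)" using x by (simp add: mult_disc_group)
  also have "\<dots> = \<phi> (k + k)"
  proof -
    have "x + x - of_int (k + k) *s y = 2 *s x - (2 * of_int k) *s y"
      by (simp add: vec_eq_iff algebra_simps)
    then show ?thesis using k by (simp only: \<phi>_def lattice_coset_eq_iff)
  qed
  also have "\<dots> = \<phi> (k mod 8) \<otimes>\<^bsub>disc_group S\<^esub> \<phi> (k mod 8)" by (simp add: \<phi>_mod \<phi>_mult)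
  finally show ?thesis
    by (intro bexI[of _ "k mod 8"]) (auto simp: carrier_integer_mod_group)
  qed
qed

text \<open>
  Every nontrivial subgroup of \<open>(\<int>/4)\<^sup>2\<close> contains an element of order 2, so \<open>y\<close> and \<open>z\<close> generate
  \<open>(\<int>/4)\<^sup>2\<close> as soon as none of the three elements \<open>2 y\<close>, \<open>2 z\<close>, \<open>2 y + 2 z\<close> vanishes.
\<close>

lemma disc_group_Z4_Z4:
  assumes y: "y \<in> dual_lattice S" "4 *s y \<in> int_vecs" "2 *s y \<notin> int_vecs"
    and z: "z \<in> dual_lattice S" "4 *s z \<in> int_vecs" "2 *s z \<notin> int_vecs"
    and yz: "2 *s y + 2 *s z \<notin> int_vecs"
    and sq: "\<And>x. x \<in> dual_lattice S \<Longrightarrow>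
      \<exists>j k. 2 *s x - (2 * of_int j) *s y - (2 * of_int k) *s z \<in> int_vecs"
  shows "\<exists>a. disc_group S \<cong>
    group_power (integer_mod_group 4) 2 \<times>\<times> group_power (integer_mod_group 2) a"
proof (rule split_off_involutions)
  define v where "v j k = of_int j *s y + of_int k *s z" for j k
  define R where "R j k \<longleftrightarrow> v j k \<in> int_vecs" for j k
  have v_add: "v j k + v j' k' = v (j + j') (k + k')" for j k j' k'
    by (simp add: v_def vec_eq_iff algebra_simps)
  have v_diff: "v j k - v j' k' = v (j - j') (k - k')" for j k j' k'
    by (simp add: v_def vec_eq_iff algebra_simps)
  have v_mult: "of_int m *s v j k = v (m * j) (m * k)" for m j k
    by (simp add: v_def vec_eq_iff algebra_simps)
  have R_mult: "R (m * j) (m * k)" if "R j k" for m j k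
    using int_vecs_scale[of "of_int m" "v j k"] that by (simp add: R_def v_mult)
  have R_add: "R (j + j') (k + k')" if "R j k" "R j' k'" for j k j' k'
    using int_vecs_add that by (simp add: R_def flip: v_add)
  have R4: "R (4 * m) (4 * n)" for m n
  proof -
    have "v (4 * m) (4 * n) = of_int m *s (4 *s y) + of_int n *s (4 *s z)"
      by (simp add: v_def vec_eq_iff)
    then show ?thesis unfolding R_def using y(2) z(2) by (simp only: int_vecs_add int_vecs_scale Ints_of_int)
  qed
  have R2: "\<not> R 2 0" "\<not> R 0 2" "\<not> R 2 2" using y(3) z(3) yz by (simp_all add: R_def v_def)
  have R_mod: "R (j mod 4) (k mod 4)" if "R j k" for j k
  proof -
    have "j mod 4 = j + 4 * (- (j div 4))" "k mod 4 = k + 4 * (- (k div 4))"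
      by (simp_all add: minus_mult_div_eq_mod)
    then show ?thesis using R_add[OF that R4] by metis
  qed
  have R_dvd: "4 dvd j \<and> 4 dvd k" if "R j k" for j k
  proof -
    have *: "j mod 4 = 0 \<and> k mod 4 = 0" if "R j k" "even j" "even k" for j k
    proof -
      have "j mod 4 = 0 \<or> j mod 4 = 2" "k mod 4 = 0 \<or> k mod 4 = 2" using that by presburger+
      then show ?thesis using R_mod[OF that(1)] R2 by auto
    qed
    have "(2 * j) mod 4 = 0 \<and> (2 * k) mod 4 = 0" using *[OF R_mult[OF that, of 2]] by simp
    then have "even j" "even k" by presburger+
    from *[OF that this] show ?thesis by presburger
  qed
  define \<phi> where "\<phi> f = lattice_coset (v (f 0) (f 1))" for f :: "nat \<Rightarrow> int"
  have vdual: "v j k \<in> dual_lattice S" for j k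
    using y(1) z(1) by (auto simp: v_def intro!: dual_lattice_add dual_lattice_scale)
  have v_mod: "lattice_coset (v (j mod 4) (k mod 4)) = lattice_coset (v j k)" for j k
  proof -
    have "j mod 4 - j = 4 * (- (j div 4))" "k mod 4 - k = 4 * (- (k div 4))"
      by (simp_all add: minus_mult_div_eq_mod[symmetric])
    then show ?thesis using R4 unfolding lattice_coset_eq_iff v_diff R_def by metis
  qed
  let ?P = "group_power (integer_mod_group 4) 2"
  have Z4: "carrier (integer_mod_group 4) = {0..<4}" by (simp add: carrier_integer_mod_group)
  show "comm_group (disc_group S)" by (rule comm_group_disc_group)
  show "finite (carrier (disc_group S))"
  proof (rule finite_disc_group)
    fix x assume x: "x \<in> dual_lattice S"
    obtain j k where jk: "2 *s x - (2 * of_int j) *s y - (2 * of_int k) *s z \<in> int_vecs"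
      using sq[OF x] by blast
    have "of_int 4 *s x = 2 *s (2 *s x - (2 * of_int j) *s y - (2 * of_int k) *s z) +
        (of_int j *s (4 *s y) + of_int k *s (4 *s z))"
      by (simp add: vec_eq_iff algebra_simps)
    also have "\<dots> \<in> int_vecs" using jk y(2) z(2) by (simp only: int_vecs_add int_vecs_scale Ints_of_int Ints_numeral)
    finally show "of_int 4 *s x \<in> int_vecs" .
  qed simp
  show "group ?P" by (simp add: group_group_power)
  show "\<phi> \<in> hom ?P (disc_group S)"
  proof (rule homI)
    show "\<phi> f \<in> carrier (disc_group S)" for f by (simp add: carrier_disc_group \<phi>_def vdual)
    show "\<phi> (f \<otimes>\<^bsub>?P\<^esub> f') = \<phi> f \<otimes>\<^bsub>disc_group S\<^esub> \<phi> f'" for f f'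
      by (simp add: \<phi>_def mult_disc_group[OF vdual vdual] v_add v_mod)
  qed
  show "inj_on \<phi> (carrier ?P)"
  proof (rule inj_onI)
    fix f f' assume f: "f \<in> carrier ?P" "f' \<in> carrier ?P" and "\<phi> f = \<phi> f'"
    then have "4 dvd f 0 - f' 0 \<and> 4 dvd f 1 - f' 1"
      using R_dvd by (simp add: \<phi>_def lattice_coset_eq_iff v_diff R_def)
    note * = this
    have "f i = f' i" if "i < 2" for i
    proof -
      have "4 dvd f i - f' i" using * less_2_cases[OF that(1)] by auto
      moreover have "f i \<in> {0..<4}" "f' i \<in> {0..<4}" using f that by (auto simp: PiE_iff Z4)
      ultimately show ?thesis by (auto simp: mod_eq_dvd_iff[symmetric])
    qed
    then show "f = f'" using f by (intro PiE_ext[of f "{..<2}" _ f']) auto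
  qed
  show "\<exists>p\<in>carrier ?P. A \<otimes>\<^bsub>disc_group S\<^esub> A = \<phi> p \<otimes>\<^bsub>disc_group S\<^esub> \<phi> p"
    if A: "A \<in> carrier (disc_group S)" for A
  proof -
  obtain x where x: "x \<in> dual_lattice S" "A = lattice_coset x" using A by (auto simp: carrier_disc_group)
  obtain j k where jk: "2 *s x - (2 * of_int j) *s y - (2 * of_int k) *s z \<in> int_vecs"
    using sq[OF x(1)] by blast
  define f where "f = (\<lambda>i\<in>{..<2::nat}. if i = 0 then j mod 4 else k mod 4)"
  have f: "\<phi> f = lattice_coset (v j k)" by (simp add: \<phi>_def f_def v_mod)
  have "A \<otimes>\<^bsub>disc_group S\<^esub> A = lattice_coset (x + x)" using x by (simp add: mult_disc_group)
  also have "\<dots> = lattice_coset (v (j + j) (k + k))"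
  proof -
    have "x + x - v (j + j) (k + k) = 2 *s x - (2 * of_int j) *s y - (2 * of_int k) *s z"
      by (simp add: v_def vec_eq_iff algebra_simps)
    then show ?thesis using jk by (simp only: lattice_coset_eq_iff)
  qed
  also have "\<dots> = \<phi> f \<otimes>\<^bsub>disc_group S\<^esub> \<phi> f" by (simp add: f mult_disc_group[OF vdual vdual] v_add)
  finally show ?thesis
    by (intro bexI[of _ f]) (auto simp: f_def Z4)
  qed
qed

section \<open>Generators of cusps\<close>

lemma additive_int_imp_scale:
  fixes F :: "int \<Rightarrow> rat ^ 'n"
  assumes add: "\<And>a b. F (a + b) = F a + F b"
  shows "F n = of_int n *s F 1"
proof -
  have F0: "F 0 = 0" using add[of 0 0] by simp
  show ?thesis
  proof (induction n rule: int_induct[where k = 0])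
    case base
    show ?case by (simp add: F0)
  next
    case (step1 i)
    then show ?case by (simp add: add vector_sadd_rdistrib)
  next
    case (step2 i)
    have "F i = F (i - 1) + F 1" using add[of "i - 1" 1] by simp
    then have "F (i - 1) = of_int i *s F 1 - F 1" using step2 by (simp add: algebra_simps)
    then show ?case by (simp add: vec_eq_iff algebra_simps)
  qed
qed

text \<open>
  The quotient of the lattice by a cusp is free, so its coordinate functions detect membership in the
  cusp and turn \<open>n x\<close> into \<open>n\<close> times an integer.
\<close>

lemma cusp_torsion_free:
  assumes I: "cusp S r I" and x: "x \<in> int_vecs" and n: "n \<noteq> 0" "of_int n *s x \<in> I"
  shows "x \<in> I"
proof -
  let ?L = "add_group int_vecs :: (rat ^ 'a) monoid"
  interpret L: comm_group ?L by (rule comm_group_int_vecs)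
  have sub: "subgroup I ?L" using I by (simp add: cusp_def)
  then have normal: "I \<lhd> ?L" using L.normal_iff_subgroup by blast
  obtain k where "?L Mod I \<cong> group_power integer_group k" using I by (auto simp: cusp_def)
  then obtain \<psi> where \<psi>: "\<psi> \<in> iso (?L Mod I) (group_power integer_group k)" by (auto simp: is_iso_def)
  define h where "h v = \<psi> (I #>\<^bsub>?L\<^esub> v)" for v
  have cos: "I #>\<^bsub>?L\<^esub> v \<in> carrier (?L Mod I)" if "v \<in> int_vecs" for v
    using that by (simp add: carrier_FactGroup)
  have h_carrier: "h v \<in> carrier (group_power integer_group k)" if "v \<in> int_vecs" for v
    using \<psi> cos[OF that] by (auto simp: h_def iso_def hom_def)
  have h_add: "h (v + w) i = h v i + h w i" if "v \<in> int_vecs" "w \<in> int_vecs" "i < k" for v w i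
  proof -
    have "I #>\<^bsub>?L\<^esub> (v + w) = (I #>\<^bsub>?L\<^esub> v) \<otimes>\<^bsub>?L Mod I\<^esub> (I #>\<^bsub>?L\<^esub> w)"
      using normal.rcos_sum[OF normal, of v w] that by simp
    then have "h (v + w) = h v \<otimes>\<^bsub>group_power integer_group k\<^esub> h w"
      using \<psi> cos that by (simp add: h_def iso_def hom_def)
    then show ?thesis using that by simp
  qed
  have h_scale: "h (of_nat m *s v) i = int m * h v i" if v: "v \<in> int_vecs" and i: "i < k" for v m i
  proof (induction m)
    case 0
    have "h (0 + 0) i = h 0 i + h 0 i" by (rule h_add) (use i in auto)
    then show ?case by simp
  next
    case (Suc m)
    have "of_nat (Suc m) *s v = of_nat m *s v + v" by (simp add: vec_eq_iff algebra_simps)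
    then show ?case using h_add[of "of_nat m *s v" v i] Suc v i
      by (simp add: int_vecs_scale algebra_simps)
  qed
  have h_eq_0: "v \<in> I" if "v \<in> int_vecs" "h v = h 0" for v
  proof -
    have "I #>\<^bsub>?L\<^esub> v = I #>\<^bsub>?L\<^esub> 0"
      using \<psi> that cos[OF that(1)] cos[of 0] unfolding h_def iso_def bij_betw_def
      by (auto dest: inj_onD)
    also have "\<dots> = I" using L.coset_mult_one[OF subgroup.subset[OF sub]] by simp
    finally show ?thesis using L.coset_join1[of I v] that(1) sub by auto
  qed
  have "of_nat (nat \<bar>n\<bar>) *s x \<in> I"
  proof (cases "n > 0")
    case False
    have "inv\<^bsub>?L\<^esub> (of_int n *s x) = - (of_int n *s x)"
      using x by (intro L.inv_equality) (auto intro!: int_vecs_minus int_vecs_scale)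
    then have "- (of_int n *s x) \<in> I" using subgroup.m_inv_closed[OF sub n(2)] by simp
    moreover have "- (of_int n *s x) = of_nat (nat \<bar>n\<bar>) *s x" using False by (simp add: vec_eq_iff)
    ultimately show ?thesis by simp
  qed (use n in auto)
  then have nI: "I #>\<^bsub>?L\<^esub> (of_nat (nat \<bar>n\<bar>) *s x) = I #>\<^bsub>?L\<^esub> 0"
    using L.coset_join2[OF _ sub] x L.coset_mult_one[OF subgroup.subset[OF sub]]
    by (simp add: int_vecs_scale)
  have "h x i = h 0 i" for i
  proof (cases "i < k")
    case True
    have "int (nat \<bar>n\<bar>) * h x i = h 0 i" using h_scale[OF x True, of "nat \<bar>n\<bar>"] nI by (simp add: h_def)
    moreover have "h 0 i = 0" using h_scale[of 0 i 0] True by simp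
    ultimately show ?thesis using n(1) by simp
  next
    case False
    then show ?thesis using h_carrier[OF x] h_carrier[of 0] by (auto simp: PiE_iff extensional_def)
  qed
  then show ?thesis using h_eq_0[OF x] by auto
qed

lemma cusp_subset: "cusp S r I \<Longrightarrow> I \<subseteq> int_vecs"
  using subgroup.subset by (fastforce simp: cusp_def)

text \<open>
  The isomorphism of the cusp with \<open>\<int>\<^sup>r\<close>, written out on functions from \<open>{..<r}\<close> to the integers so
  that a basis can be read off.
\<close>

lemma cusp_parametrization:
  assumes "cusp S r I"
  shows "\<exists>\<phi>. bij_betw \<phi> ({..<r} \<rightarrow>\<^sub>E UNIV) I \<and>
    (\<forall>f\<in>{..<r} \<rightarrow>\<^sub>E UNIV. \<forall>f'\<in>{..<r} \<rightarrow>\<^sub>E UNIV.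
       \<phi> (\<lambda>i\<in>{..<r}. f i + f' i :: int) = \<phi> f + \<phi> f')"
proof -
  interpret L: comm_group "add_group int_vecs :: (rat ^ 'a) monoid" by (rule comm_group_int_vecs)
  have "subgroup I (add_group int_vecs)" and iso: "add_group I \<cong> group_power integer_group r"
    using assms by (auto simp: cusp_def)
  then have "group (add_group int_vecs\<lparr>carrier := I\<rparr>)" using L.subgroup_imp_group by blast
  then have "group (add_group I)" by (simp add: add_group_def)
  from group.iso_sym[OF this iso] obtain \<phi>
    where \<phi>: "\<phi> \<in> iso (group_power integer_group r) (add_group I)" by (auto simp: is_iso_def)
  then show ?thesis by (intro exI[of _ \<phi>]) (auto simp: iso_def hom_def)
qed

text \<open>
  Primitivity inside the cusp is enough, because the cusp contains each lattice vector of which it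
  contains a nonzero multiple.
\<close>

lemma primitive_if_saturated:
  assumes I: "cusp S r I" and e: "e \<in> I" "e \<noteq> 0"
    and div: "\<And>c. c *s e \<in> I \<Longrightarrow> c \<in> \<int>"
  shows "primitive_vec e"
  unfolding primitive_vec_def
proof (intro conjI allI impI)
  show "e \<in> int_vecs" using e(1) cusp_subset[OF I] by blast
  fix c assume c: "c *s e \<in> int_vecs"
  obtain p q where pq: "quotient_of c = (p, q)" by force
  have q: "q > 0" using quotient_of_denom_pos[OF pq] .
  have cpq: "c = of_int p / of_int q" using quotient_of_div[OF pq] .
  have sub: "subgroup I (add_group int_vecs)" using I by (simp add: cusp_def)
  interpret L: comm_group "add_group int_vecs :: (rat ^ 'a) monoid" by (rule comm_group_int_vecs)
  have add: "x + y \<in> I" if "x \<in> I" "y \<in> I" for x y using subgroup.m_closed[OF sub that] by simp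
  have zero: "0 \<in> I" using subgroup.one_closed[OF sub] by simp
  have minus: "- x \<in> I" if "x \<in> I" for x
  proof -
    have "inv\<^bsub>add_group int_vecs\<^esub> x = - x"
      using that cusp_subset[OF I] by (intro L.inv_equality) (auto intro!: int_vecs_minus)
    then show ?thesis using subgroup.m_inv_closed[OF sub that] by simp
  qed
  have "of_int n *s e \<in> I" for n
  proof (induction n rule: int_induct[where k = 0])
    case base
    show ?case using zero by simp
  next
    case (step1 i)
    then show ?case using add[OF _ e(1)] by (simp add: vector_sadd_rdistrib)
  next
    case (step2 i)
    have "of_int (i - 1) *s e = of_int i *s e + - e" by (simp add: vec_eq_iff algebra_simps)
    then show ?case using add[OF step2(2) minus[OF e(1)]] by simp
  qed
  moreover have "of_int q *s (c *s e) = of_int p *s e" using q by (simp add: cpq)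
  ultimately have "of_int q *s (c *s e) \<in> I" by metis
  then have "c *s e \<in> I" by (rule cusp_torsion_free[OF I c, rotated]) (use q in simp)
  then show "c \<in> \<int>" by (rule div)
qed (use e in auto)

lemma cusp1_generator:
  assumes I: "cusp S 1 I"
  obtains e where "primitive_vec e" "I = range (\<lambda>n. of_int n *s e)"
proof -
  obtain \<phi> where bij: "bij_betw \<phi> ({..<1::nat} \<rightarrow>\<^sub>E UNIV) I"
    and add: "\<And>f f'. f \<in> {..<1::nat} \<rightarrow>\<^sub>E UNIV \<Longrightarrow> f' \<in> {..<1} \<rightarrow>\<^sub>E UNIV \<Longrightarrow>
       \<phi> (\<lambda>i\<in>{..<1}. f i + f' i :: int) = \<phi> f + \<phi> f'"
    using cusp_parametrization[OF I] by blast
  define F where "F n = \<phi> (\<lambda>i\<in>{..<1}. n)" for n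
  have F_add: "F (a + b) = F a + F b" for a b
    using add[of "\<lambda>i\<in>{..<1}. a" "\<lambda>i\<in>{..<1}. b"] by (simp add: F_def cong: restrict_cong)
  note F = additive_int_imp_scale[of F, OF F_add]
  have rng: "f = (\<lambda>i\<in>{..<1}. f 0)" if "f \<in> {..<1::nat} \<rightarrow>\<^sub>E (UNIV :: int set)" for f
    using that by (fastforce simp: PiE_iff extensional_def restrict_def)
  have I_eq: "I = range F"
  proof
    show "I \<subseteq> range F"
    proof
      fix x assume "x \<in> I"
      then obtain f where "f \<in> {..<1} \<rightarrow>\<^sub>E UNIV" "x = \<phi> f" using bij by (auto simp: bij_betw_def)
      then have "x = F (f 0)" using rng[of f] by (simp add: F_def)
      then show "x \<in> range F" by blast
    qed
    show "range F \<subseteq> I" using bij by (auto simp: F_def bij_betw_def)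
  qed
  have inj: "a = b" if "F a = F b" for a b
  proof -
    have "(\<lambda>i\<in>{..<1::nat}. a) = (\<lambda>i\<in>{..<1}. b)"
      using that bij unfolding F_def bij_betw_def by (intro inj_onD[of \<phi> "{..<1} \<rightarrow>\<^sub>E UNIV"]) auto
    then show ?thesis by (metis lessThan_iff less_one restrict_apply')
  qed
  have F0: "F 0 = 0" using F[of 0] by simp
  have ne: "F 1 \<noteq> 0" using inj[of 1 0] F0 by auto
  have "primitive_vec (F 1)"
  proof (rule primitive_if_saturated[OF I])
    show "F 1 \<in> I" using I_eq by blast
    show "F 1 \<noteq> 0" by (rule ne)
    fix c assume "c *s F 1 \<in> I"
    then obtain n where "c *s F 1 = F n" using I_eq by blast
    also have "F n = of_int n *s F 1" by (rule F)
    finally have "c = of_int n" using ne by (simp add: vec.scale_right_imp_eq)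
    then show "c \<in> \<int>" by simp
  qed
  moreover have "I = range (\<lambda>n. of_int n *s F 1)" unfolding I_eq by (intro image_cong refl F)
  ultimately show thesis by (rule that)
qed

text \<open>
  The line spanned by the first basis vector is the one to which the plane will be reduced.
\<close>

lemma cusp2_basis:
  assumes J: "cusp S 2 J"
  shows "\<exists>e f. primitive_vec e \<and> J = {of_int m *s e + of_int n *s f | m n. True} \<and>
    (\<forall>m n. of_int m *s e + of_int n *s f = 0 \<longrightarrow> n = 0)"
proof -
  obtain \<phi> where bij: "bij_betw \<phi> ({..<2::nat} \<rightarrow>\<^sub>E UNIV) J"
    and add: "\<And>f f'. f \<in> {..<2::nat} \<rightarrow>\<^sub>E UNIV \<Longrightarrow> f' \<in> {..<2} \<rightarrow>\<^sub>E UNIV \<Longrightarrow>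
       \<phi> (\<lambda>i\<in>{..<2}. f i + f' i :: int) = \<phi> f + \<phi> f'"
    using cusp_parametrization[OF J] by blast
  define p where "p m n = (\<lambda>i\<in>{..<2::nat}. if i = 0 then m else n)" for m n :: int
  have p_mem: "p m n \<in> {..<2} \<rightarrow>\<^sub>E UNIV" for m n by (simp add: p_def)
  define F where "F m n = \<phi> (p m n)" for m n
  have F_add: "F (a + a') (b + b') = F a b + F a' b'" for a b a' b'
  proof -
    have "p (a + a') (b + b') = (\<lambda>i\<in>{..<2}. p a b i + p a' b' i)"
      by (auto simp: p_def restrict_def)
    then show ?thesis unfolding F_def using add[OF p_mem p_mem] by simp
  qed
  have F1: "F m 0 = of_int m *s F 1 0" for m
    by (rule additive_int_imp_scale[of "\<lambda>m. F m 0"]) (use F_add[of _ _ 0 0] in simp)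
  have F2: "F 0 n = of_int n *s F 0 1" for n
    by (rule additive_int_imp_scale[of "\<lambda>n. F 0 n"]) (use F_add[of 0 0] in simp)
  have F: "F m n = of_int m *s F 1 0 + of_int n *s F 0 1" for m n
    using F_add[of m 0 0 n] F1[of m] F2[of n] by simp
  have J_eq: "J = {F m n | m n. True}"
  proof
    show "J \<subseteq> {F m n | m n. True}"
    proof
      fix x assume "x \<in> J"
      then obtain f where f: "f \<in> {..<2} \<rightarrow>\<^sub>E UNIV" "x = \<phi> f" using bij by (auto simp: bij_betw_def)
      have "f = p (f 0) (f 1)"
      proof (rule PiE_ext[OF f(1) p_mem])
        fix i :: nat assume "i \<in> {..<2}"
        then show "f i = p (f 0) (f 1) i" using less_2_cases[of i] by (auto simp: p_def)
      qed
      then have "x = F (f 0) (f 1)" using f by (simp add: F_def)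
      then show "x \<in> {F m n | m n. True}" by blast
    qed
    show "{F m n | m n. True} \<subseteq> J" using bij p_mem by (auto simp: F_def bij_betw_def)
  qed
  have inj: "a = a' \<and> b = b'" if "F a b = F a' b'" for a b a' b'
  proof -
    have "p a b = p a' b'"
      using that bij p_mem unfolding F_def bij_betw_def by (meson inj_onD)
    then have "p a b 0 = p a' b' 0" "p a b 1 = p a' b' 1" by simp_all
    then show ?thesis by (simp add: p_def)
  qed
  have F00: "F 0 0 = 0" using F[of 0 0] by simp
  have ne: "F 1 0 \<noteq> 0" using inj[of 1 0 0 0] F00 by auto
  have "primitive_vec (F 1 0)"
  proof (rule primitive_if_saturated[OF J])
    show "F 1 0 \<in> J" using J_eq by blast
    show "F 1 0 \<noteq> 0" by (rule ne)
    fix c assume "c *s F 1 0 \<in> J"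
    then obtain m n where mn: "c *s F 1 0 = F m n" using J_eq by blast
    obtain k where k: "quotient_of c = k" by blast
    have q: "snd k > 0" and cq: "c = of_int (fst k) / of_int (snd k)"
      using quotient_of_denom_pos[of c "fst k" "snd k"] quotient_of_div[of c "fst k" "snd k"] k by auto
    have "F (fst k) 0 = of_int (snd k) *s (c *s F 1 0)" using q by (simp add: F1[of "fst k"] cq)
    also have "\<dots> = F (snd k * m) (snd k * n)"
      unfolding mn F[of m n] F[of "snd k * m" "snd k * n"] by (simp add: vec_eq_iff algebra_simps)
    finally have "n = 0" "fst k = snd k * m" using inj q by fastforce+
    then have "c = of_int m" using q by (simp add: cq)
    then show "c \<in> \<int>" by simp
  qed
  moreover define e f where "e = F 1 0" and "f = F 0 1"
  then have F': "F m n = of_int m *s e + of_int n *s f" for m n by (simp only: F[of m n])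
  then have "J = {of_int m *s e + of_int n *s f | m n. True}" by (simp add: J_eq)
  moreover have "n = 0" if "of_int m *s e + of_int n *s f = 0" for m n
    using inj[of m n 0 0] that by (simp add: F')
  ultimately show ?thesis unfolding e_def[symmetric] by blast
qed

section \<open>Irregular cusps restrict the discriminant group\<close>

definition complexify :: "rat ^ 'n ^ 'n \<Rightarrow> complex ^ 'n ^ 'n" where
  "complexify g = (\<chi> i j. of_rat (g $ i $ j))"

lemma complexify_mult: "complexify (g ** h) = complexify g ** complexify h"
  by (simp add: complexify_def matrix_matrix_mult_def vec_eq_iff of_rat_sum of_rat_mult)

lemma complexify_mat_1: "complexify (mat 1) = mat 1"
  by (simp add: complexify_def mat_def vec_eq_iff)

lemma act_line_eq: "act_line g l = (*v) (complexify g) ` l"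
  by (simp add: act_line_def complexify_def)

lemma act_line_mult: "act_line (g ** h) l = act_line g (act_line h l)"
  by (simp add: act_line_eq complexify_mult image_image matrix_vector_mul_assoc)

lemma act_line_mat_1: "act_line (mat 1) l = l"
  by (simp add: act_line_eq complexify_mat_1)

lemma act_line_cline: "act_line g (cline w) = cline (complexify g *v w)"
  by (simp add: act_line_eq cline_def image_image vec.scale)

lemma minus_matrix_vector: "(- g) *v x = - (g *v x :: 'a::comm_ring_1 ^ 'n)"
  by (simp add: matrix_vector_mult_def vec_eq_iff sum_negf)

lemma act_line_minus_cline: "act_line (- g) (cline w) = act_line g (cline w)"
proof -
  have c: "complexify (- g) = - complexify g"
    by (simp add: complexify_def vec_eq_iff of_rat_minus)
  have sub: "cline (- v) \<subseteq> cline v" for v :: "complex ^ 'n"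
  proof
    fix x assume "x \<in> cline (- v)"
    then obtain c where "x = (- c) *s v" by (auto simp: cline_def)
    then show "x \<in> cline v" unfolding cline_def by blast
  qed
  have "cline (- v) = cline v" for v :: "complex ^ 'n"
    using sub[of v] sub[of "- v"] by auto
  then show ?thesis by (simp add: act_line_cline c minus_matrix_vector)
qed

lemma period_component_lines:
  assumes "D \<in> period_components S" "l \<in> D"
  obtains w where "l = cline w" "w \<noteq> 0" "bform S w w = 0"
    "bform S w (\<chi> i. cnj (w $ i)) \<in> \<real>" "Re (bform S w (\<chi> i. cnj (w $ i))) > 0"
proof -
  have "D \<subseteq> topspace (subtopology proj_space (period_domain S))"
    using assms(1) unfolding period_components_def
    using connected_components_of_subset by blast
  then have "l \<in> period_domain S" using assms(2) by auto
  then show thesis using that by (auto simp: period_domain_def)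
qed

text \<open>
  Minus the identity fixes every complex line, hence acts trivially on the period domain.
\<close>

lemma act_line_minus:
  assumes "D \<in> period_components S"
  shows "act_line (- g) ` D = act_line g ` D"
proof (rule image_cong[OF refl])
  fix l assume "l \<in> D"
  then obtain w where "l = cline w" using period_component_lines[OF assms] by metis
  then show "act_line (- g) l = act_line g l" by (simp add: act_line_minus_cline)
qed

lemma carrier_orth_groupD:
  assumes "g \<in> carrier (orth_group S)"
  shows "bform S (g *v x) (g *v y) = bform S x y"
  using assms by (simp add: orth_group_def)

lemma minus_in_orth_group:
  assumes "g \<in> carrier (orth_group S)"
  shows "- g \<in> carrier (orth_group S)"
proof -
  obtain h where h: "g ** h = mat 1" "h ** g = mat 1"
    using assms by (auto simp: orth_group_def invertible_def)
  have "(- g) ** (- h) = g ** h" for g h :: "rat ^ 'a ^ 'a"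
    by (simp add: matrix_matrix_mult_def vec_eq_iff)
  then have "invertible (- g)" unfolding invertible_def using h by metis
  then show ?thesis
    using assms by (simp add: orth_group_def minus_matrix_vector bform_minus_left bform_minus_right)
qed

lemma image_uminus_int_vecs: "uminus ` int_vecs = (int_vecs :: (rat ^ 'n) set)"
proof -
  have "x \<in> uminus ` int_vecs" if "x \<in> int_vecs" for x :: "rat ^ 'n"
    using that int_vecs_minus[OF that] by (intro image_eqI[of _ _ "- x"]) auto
  then show ?thesis by (auto intro: int_vecs_minus)
qed

lemma subgroup_stable_O_plus: "subgroup (stable_O_plus S D) (orth_group S)"
proof -
  interpret O: group "orth_group S" by (rule group_orth_group)
  show ?thesis
  proof (rule O.subgroupI)
    show "stable_O_plus S D \<subseteq> carrier (orth_group S)"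
      by (auto simp: stable_O_plus_def O_plus_def O_plus_rat_def)
    have "mat 1 \<in> carrier (orth_group S)" using O.one_closed by (simp add: orth_group_def)
    then have "mat 1 \<in> stable_O_plus S D"
      by (simp add: stable_O_plus_def O_plus_def O_plus_rat_def act_line_mat_1)
    then show "stable_O_plus S D \<noteq> {}" by blast
  next
    fix g assume g: "g \<in> stable_O_plus S D"
    then have g': "g \<in> carrier (orth_group S)" "act_line g ` D = D" "(*v) g ` int_vecs = int_vecs"
      "\<And>x. x \<in> dual_lattice S \<Longrightarrow> g *v x - x \<in> int_vecs"
      by (auto simp: stable_O_plus_def O_plus_def O_plus_rat_def)
    define h where "h = inv\<^bsub>orth_group S\<^esub> g"
    have h: "h \<in> carrier (orth_group S)" using g'(1) by (simp add: h_def)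
    have "h \<otimes>\<^bsub>orth_group S\<^esub> g = \<one>\<^bsub>orth_group S\<^esub>" using g'(1) by (simp add: h_def)
    then have hg: "h ** g = mat 1" by (simp add: orth_group_def)
    then have hgv: "h *v (g *v x) = x" for x by (simp add: matrix_vector_mul_assoc)
    have "act_line h ` D = act_line h ` (act_line g ` D)" by (simp only: g'(2))
    also have "\<dots> = D" by (simp add: image_image hg act_line_mat_1 flip: act_line_mult)
    finally have hD: "act_line h ` D = D" .
    have "(*v) h ` int_vecs = (*v) h ` ((*v) g ` int_vecs)" by (simp only: g'(3))
    also have "\<dots> = int_vecs" by (simp add: image_image hgv)
    finally have hL: "(*v) h ` int_vecs = int_vecs" .
    have "h *v x - x \<in> int_vecs" if "x \<in> dual_lattice S" for x
    proof -
      have "h *v x - x = - (h *v (g *v x - x))" by (simp add: matrix_vector_mult_diff_distrib hgv)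
      then show ?thesis using g'(4)[OF that] hL int_vecs_minus by (metis imageI)
    qed
    then have "h \<in> stable_O_plus S D"
      using h hD hL by (simp add: stable_O_plus_def O_plus_def O_plus_rat_def)
    then show "inv\<^bsub>orth_group S\<^esub> g \<in> stable_O_plus S D" by (simp add: h_def)
  next
    fix g h assume g: "g \<in> stable_O_plus S D" and h: "h \<in> stable_O_plus S D"
    then have g': "g \<in> carrier (orth_group S)" "act_line g ` D = D" "(*v) g ` int_vecs = int_vecs"
        "\<And>x. x \<in> dual_lattice S \<Longrightarrow> g *v x - x \<in> int_vecs"
      and h': "h \<in> carrier (orth_group S)" "act_line h ` D = D" "(*v) h ` int_vecs = int_vecs"
        "\<And>x. x \<in> dual_lattice S \<Longrightarrow> h *v x - x \<in> int_vecs"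
      by (auto simp: stable_O_plus_def O_plus_def O_plus_rat_def)
    have "g ** h \<in> carrier (orth_group S)" using O.m_closed[OF g'(1) h'(1)] by (simp add: orth_group_def)
    moreover have "act_line (g ** h) ` D = D"
    proof -
      have "act_line (g ** h) ` D = act_line g ` (act_line h ` D)" by (simp add: image_image act_line_mult)
      then show ?thesis by (simp add: g' h')
    qed
    moreover have "(*v) (g ** h) ` int_vecs = int_vecs"
    proof -
      have "(*v) (g ** h) ` int_vecs = (*v) g ` ((*v) h ` int_vecs)"
        by (simp add: image_image matrix_vector_mul_assoc)
      then show ?thesis by (simp only: g' h')
    qed
    moreover have "(g ** h) *v x - x \<in> int_vecs" if "x \<in> dual_lattice S" for x
    proof -
      have "(g ** h) *v x - x = g *v (h *v x - x) + (g *v x - x)"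
        by (simp add: matrix_vector_mult_diff_distrib matrix_vector_mul_assoc)
      then show ?thesis using g'(3) g'(4)[OF that] h'(4)[OF that] int_vecs_add by (metis imageI)
    qed
    ultimately have "g ** h \<in> stable_O_plus S D"
      by (simp add: stable_O_plus_def O_plus_def O_plus_rat_def)
    then show "g \<otimes>\<^bsub>orth_group S\<^esub> h \<in> stable_O_plus S D" by (simp add: orth_group_def)
  qed
qed

text \<open>
  As \<open>-1\<close> is central of order 2, the union of \<open>\<Gamma>\<close> and \<open>- \<Gamma>\<close> is already a group.
\<close>

lemma with_neg_id_subgroup:
  assumes \<Gamma>: "subgroup \<Gamma> (orth_group S)" and g: "g \<in> with_neg_id S \<Gamma>"
  shows "g \<in> \<Gamma> \<or> - g \<in> \<Gamma>"
proof -
  interpret O: group "orth_group S" by (rule group_orth_group)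
  have mult: "x \<otimes>\<^bsub>orth_group S\<^esub> y = x ** y" for x y by (simp add: orth_group_def)
  have one: "\<one>\<^bsub>orth_group S\<^esub> = mat 1" by (simp add: orth_group_def)
  have neg_mult: "(- a) ** b = - (a ** b)" "a ** (- b) = - (a ** b)" for a b :: "rat ^ 'a ^ 'a"
    by (simp_all add: matrix_matrix_mult_def vec_eq_iff sum_negf)
  have neg1: "- mat 1 \<in> carrier (orth_group S)"
    using minus_in_orth_group O.one_closed by (simp add: one)
  have "inv\<^bsub>orth_group S\<^esub> (- mat 1) = - mat 1"
    using neg1 by (intro O.inv_equality) (simp_all add: mult one neg_mult)
  then have neg1_inv: "- (inv\<^bsub>orth_group S\<^esub> (- mat 1)) = \<one>\<^bsub>orth_group S\<^esub>" by (simp add: one)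
  show ?thesis
    using g unfolding with_neg_id_def
  proof (induction rule: generate.induct)
    case one
    then show ?case using subgroup.one_closed[OF \<Gamma>] by blast
  next
    case (incl h)
    then show ?case using subgroup.one_closed[OF \<Gamma>] by (auto simp: one)
  next
    case (inv h)
    then show ?case
      using subgroup.one_closed[OF \<Gamma>] subgroup.m_inv_closed[OF \<Gamma>, of h] neg1_inv by auto
  next
    case (eng h1 h2)
    have cl: "a ** b \<in> \<Gamma>" if "a \<in> \<Gamma>" "b \<in> \<Gamma>" for a b
      using subgroup.m_closed[OF \<Gamma> that] by (simp add: mult)
    show ?case
      using eng.IH cl[of h1 h2] cl[of "- h1" h2] cl[of h1 "- h2"] cl[of "- h1" "- h2"]
      by (auto simp: mult neg_mult)
  qed
qed

text \<open>
  The extra element \<open>g\<close> has \<open>- g\<close> in the stable group, which says that \<open>g\<close> acts as \<open>-1\<close> on the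
  discriminant group; as \<open>g\<close> itself is not stable, \<open>-1\<close> acts nontrivially there.
\<close>

lemma irregular_witness:
  assumes D: "D \<in> period_components S"
    and U: "U \<subseteq> O_plus_rat S D" "U \<inter> stable_O_plus S D \<noteq> U \<inter> with_neg_id S (stable_O_plus S D)"
  obtains g where "g \<in> U" "(*v) g ` int_vecs = int_vecs"
    "\<forall>x\<in>dual_lattice S. g *v x + x \<in> int_vecs"
    "\<exists>x\<in>dual_lattice S. 2 *s x \<notin> int_vecs"
proof -
  let ?\<Gamma> = "stable_O_plus S D"
  have "?\<Gamma> \<subseteq> with_neg_id S ?\<Gamma>"
    unfolding with_neg_id_def by (auto intro: generate.incl)
  then obtain g where g: "g \<in> U" "g \<in> with_neg_id S ?\<Gamma>" "g \<notin> ?\<Gamma>" using U(2) by blast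
  then have neg: "- g \<in> ?\<Gamma>" using with_neg_id_subgroup[OF subgroup_stable_O_plus] by blast
  have "(*v) (- g) ` int_vecs = int_vecs"
    using neg by (simp add: stable_O_plus_def O_plus_def)
  then have "uminus ` ((*v) (- g) ` int_vecs) = int_vecs" by (simp only: image_uminus_int_vecs)
  then have gL: "(*v) g ` int_vecs = int_vecs" by (simp add: image_image minus_matrix_vector)
  have gneg: "g *v x + x \<in> int_vecs" if "x \<in> dual_lattice S" for x
  proof -
    have "(- g) *v x - x \<in> int_vecs" using neg that by (simp add: stable_O_plus_def)
    then show ?thesis using int_vecs_minus[of "(- g) *v x - x"] by (simp add: minus_matrix_vector add.commute)
  qed
  obtain x where x: "x \<in> dual_lattice S" "g *v x - x \<notin> int_vecs"
    using g U(1) gL unfolding stable_O_plus_def O_plus_def by blast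
  have "2 *s x \<notin> int_vecs"
  proof
    assume "2 *s x \<in> int_vecs"
    moreover have "g *v x - x = (g *v x + x) - 2 *s x" by (simp add: vec_eq_iff)
    ultimately show False using x(2) int_vecs_diff[OF gneg[OF x(1)], of "2 *s x"] by metis
  qed
  then show thesis using that g(1) gL gneg x(1) by blast
qed

lemma disc_group_of_unipotent:
  assumes "even_lattice S" "primitive_vec e" "bform S e e = 0"
    and "g \<in> carrier (orth_group S)" "g *v e = e"
    and "\<forall>x. bform S e x = 0 \<longrightarrow> (\<exists>c. g *v x - x = c *s e)"
    and "(*v) g ` int_vecs = int_vecs"
    and "\<forall>x\<in>dual_lattice S. g *v x + x \<in> int_vecs"
    and "\<exists>x\<in>dual_lattice S. 2 *s x \<notin> int_vecs"
  shows "(\<exists>a. disc_group S \<cong> integer_mod_group 8 \<times>\<times> group_power (integer_mod_group 2) a) \<or>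
    (\<exists>a. disc_group S \<cong> group_power (integer_mod_group 4) 2 \<times>\<times> group_power (integer_mod_group 2) a)"
proof -
  have "\<forall>x\<in>int_vecs. g *v x \<in> int_vecs" using assms(7) by blast
  from unipotent_acting_as_minus_one[OF assms(1-3) carrier_orth_groupD[OF assms(4)] assms(5,6) this
      assms(8,9)]
  show ?thesis
  proof (elim disjE bexE conjE)
    fix y assume "y \<in> dual_lattice S" "8 *s y \<in> int_vecs" "4 *s y \<notin> int_vecs"
      "\<forall>x\<in>dual_lattice S. \<exists>k. 2 *s x - (2 * of_int k) *s y \<in> int_vecs"
    then show ?thesis using disc_group_Z8[of y S] by blast
  next
    fix y z assume "y \<in> dual_lattice S" "z \<in> dual_lattice S" "4 *s y \<in> int_vecs" "4 *s z \<in> int_vecs"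
      "2 *s y \<notin> int_vecs" "2 *s z \<notin> int_vecs" "2 *s y + 2 *s z \<notin> int_vecs"
      "\<forall>x\<in>dual_lattice S. \<exists>j k. 2 *s x - (2 * of_int j) *s y - (2 * of_int k) *s z \<in> int_vecs"
    then show ?thesis using disc_group_Z4_Z4[of y S z] by blast
  qed
qed

lemma perp_rat_memI:
  assumes "I \<subseteq> vec.span B" "\<And>y. y \<in> B \<Longrightarrow> bform S x y = 0"
  shows "x \<in> perp_rat S I"
proof -
  have "vec.subspace {y. bform S x y = 0}"
    by (auto simp: vec.subspace_def bform_simps)
  then have "vec.span B \<subseteq> {y. bform S x y = 0}"
    using assms(2) by (intro vec.span_minimal) auto
  moreover have "vec.span I \<subseteq> vec.span B" using assms(1) by (simp add: vec.span_minimal)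
  ultimately show ?thesis by (auto simp: perp_rat_def)
qed

lemma disc_group_of_irregular_cusp0:
  assumes S: "even_lattice S" and D: "D \<in> period_components S"
    and irr: "has_irregular_cusp0 S D (stable_O_plus S D)"
  shows "(\<exists>a. disc_group S \<cong> integer_mod_group 8 \<times>\<times> group_power (integer_mod_group 2) a) \<or>
    (\<exists>a. disc_group S \<cong> group_power (integer_mod_group 4) 2 \<times>\<times> group_power (integer_mod_group 2) a)"
proof -
  obtain I where I: "cusp S 1 I"
    and ne: "U0_rat S D I \<inter> stable_O_plus S D \<noteq> U0_rat S D I \<inter> with_neg_id S (stable_O_plus S D)"
    using irr by (auto simp: has_irregular_cusp0_def)
  obtain g where g: "g \<in> U0_rat S D I" "(*v) g ` int_vecs = int_vecs"
      "\<forall>x\<in>dual_lattice S. g *v x + x \<in> int_vecs"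
      "\<exists>x\<in>dual_lattice S. 2 *s x \<notin> int_vecs"
    using irregular_witness[OF D _ ne] by (auto simp: U0_rat_def)
  obtain e where e: "primitive_vec e" "I = range (\<lambda>n. of_int n *s e)"
    by (rule cusp1_generator[OF I])
  have eI: "e \<in> I" unfolding e(2) by (rule range_eqI[of _ _ 1]) simp
  have span: "I \<subseteq> vec.span {e}" unfolding e(2) by (auto simp: vec.span_singleton)
  show ?thesis
  proof (rule disc_group_of_unipotent[OF S e(1) _ _ _ _ g(2,3,4)])
    show "bform S e e = 0" using I eI by (auto simp: cusp_def)
    show "g \<in> carrier (orth_group S)" using g(1) by (simp add: U0_rat_def O_plus_rat_def)
    show "g *v e = e" using g(1) eI by (simp add: U0_rat_def)
    show "\<forall>x. bform S e x = 0 \<longrightarrow> (\<exists>c. g *v x - x = c *s e)"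
    proof (intro allI impI)
      fix x assume "bform S e x = 0"
      then have "x \<in> perp_rat S I"
        by (intro perp_rat_memI[OF span]) (auto simp: bform_commute[OF S, of x])
      then have "g *v x - x \<in> vec.span I" using g(1) by (simp add: U0_rat_def)
      then have "g *v x - x \<in> vec.span {e}" using span vec.span_minimal by (metis subsetD vec.subspace_span)
      then show "\<exists>c. g *v x - x = c *s e" by (auto simp: vec.span_singleton)
    qed
  qed
qed

text \<open>
  The unipotent radical at a one-dimensional cusp acts on the isotropic plane by an alternating
  form: \<open>g x - x\<close> lies in the plane and is orthogonal to \<open>x\<close>.  Hence it is proportional to \<open>e\<close>
  whenever \<open>x\<close> is orthogonal to \<open>e\<close>, so that every irregular one-dimensional cusp contains an
  irregular zero-dimensional one.
\<close>

lemma trivial_on_plane_perp: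
  assumes S: "even_lattice S" and g: "g \<in> carrier (orth_group S)"
    and e: "primitive_vec e" and iso: "bform S e e = 0" "bform S e f = 0" "bform S f f = 0"
    and indep: "\<And>c. f \<noteq> c *s e"
    and triv: "\<And>x. bform S e x = 0 \<Longrightarrow> bform S f x = 0 \<Longrightarrow> g *v x = x"
    and x: "bform S e x = 0"
  shows "\<exists>c. g *v x - x = c *s e"
proof -
  note comm = bform_commute[OF S] and isom = carrier_orth_groupD[OF g]
  let ?v = "g *v x - x"
  obtain y where y: "bform S e y = 1" by (rule primitive_vec_dual_partner[OF S e])
  \<comment> \<open>The vectors \<open>y\<close>, \<open>z\<close> are dual to the basis \<open>e\<close>, \<open>f'\<close> of the plane; subtracting its components
    along them moves any vector into the orthogonal complement of the plane.\<close>
  define f' where "f' = f - bform S f y *s e"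
  have "f' \<noteq> 0" using indep[of "bform S f y"] by (simp add: f'_def)
  then obtain z0 where z0: "bform S f' z0 \<noteq> 0" using bform_nondegenerate[OF S] by blast
  define z1 where "z1 = (1 / bform S f' z0) *s z0"
  define z where "z = z1 - bform S e z1 *s y"
  have f'y: "bform S f' y = 0" by (simp add: f'_def bform_simps y)
  have z: "bform S e z = 0" "bform S f' z = 1"
    using z0 by (simp_all add: z_def z1_def bform_simps y f'y)
  have v_perp: "bform S ?v w = 0" if "bform S e w = 0" "bform S f w = 0" for w
    using isom[of x w] triv[OF that] by (simp add: bform_simps)
  define \<alpha> \<beta> where "\<alpha> = bform S ?v y" and "\<beta> = bform S ?v z"
  have v: "?v = \<alpha> *s e + \<beta> *s f'"
  proof -
    have "bform S (?v - (\<alpha> *s e + \<beta> *s f')) w = 0" for w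
    proof -
      let ?w = "w - bform S e w *s y - bform S f' w *s z"
      have 1: "bform S e ?w = 0" "bform S f' ?w = 0"
        by (simp_all add: bform_simps y z f'y)
      have "f = f' + bform S f y *s e" by (simp add: f'_def)
      then have "bform S f ?w = bform S f' ?w + bform S f y * bform S e ?w"
        by (metis bform_add_left bform_scale_left)
      then have "bform S ?v ?w = 0" using v_perp 1 by simp
      then have "bform S ?v w = bform S e w * \<alpha> + bform S f' w * \<beta>"
        by (simp only: bform_diff_right[of S ?v] bform_scale_right \<alpha>_def \<beta>_def)
      then show ?thesis by (simp only: bform_diff_left[of S ?v] bform_add_left bform_scale_left)
          (simp add: algebra_simps)
    qed
    then show ?thesis using bform_nondegenerate[OF S] by (metis eq_iff_diff_eq_0)
  qed
  have "bform S ?v ?v = 0"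
    unfolding v by (simp add: f'_def bform_simps iso comm[of f e])
  then have "bform S x ?v = 0" using isom[of x x] by (simp add: bform_simps comm[of "g *v x" x])
  then have "\<beta> * bform S f' x = 0"
    unfolding v using x by (simp add: bform_simps comm[of x])
  then consider "\<beta> = 0" | "bform S f x = 0" using x by (auto simp: f'_def bform_simps)
  then show ?thesis
  proof cases
    case 1
    then show ?thesis using v by auto
  next
    case 2
    then show ?thesis using triv[OF x] by (intro exI[of _ 0]) simp
  qed
qed

lemma disc_group_of_irregular_cusp1:
  assumes S: "even_lattice S" and D: "D \<in> period_components S"
    and irr: "has_irregular_cusp1 S D (stable_O_plus S D)"
  shows "(\<exists>a. disc_group S \<cong> integer_mod_group 8 \<times>\<times> group_power (integer_mod_group 2) a) \<or>
    (\<exists>a. disc_group S \<cong> group_power (integer_mod_group 4) 2 \<times>\<times> group_power (integer_mod_group 2) a)"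
proof -
  obtain J where J: "cusp S 2 J"
    and ne: "U1_rat S D J \<inter> stable_O_plus S D \<noteq> U1_rat S D J \<inter> with_neg_id S (stable_O_plus S D)"
    using irr by (auto simp: has_irregular_cusp1_def)
  obtain g where g: "g \<in> U1_rat S D J" "(*v) g ` int_vecs = int_vecs"
      "\<forall>x\<in>dual_lattice S. g *v x + x \<in> int_vecs"
      "\<exists>x\<in>dual_lattice S. 2 *s x \<notin> int_vecs"
    using irregular_witness[OF D _ ne] by (auto simp: U1_rat_def)
  obtain e f where e: "primitive_vec e" and J_eq: "J = {of_int m *s e + of_int n *s f | m n. True}"
    and indep: "\<And>m n. of_int m *s e + of_int n *s f = 0 \<Longrightarrow> n = 0"
    using cusp2_basis[OF J] by blast
  have "of_int 1 *s e + of_int 0 *s f \<in> J" "of_int 0 *s e + of_int 1 *s f \<in> J"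
    unfolding J_eq by blast+
  then have mem: "e \<in> J" "f \<in> J" by simp_all
  then have iso: "bform S e e = 0" "bform S e f = 0" "bform S f f = 0"
    using J by (auto simp: cusp_def)
  have span: "J \<subseteq> vec.span {e, f}"
  proof
    fix x assume "x \<in> J"
    then obtain m n where "x = of_int m *s e + of_int n *s f" by (auto simp: J_eq)
    moreover have "e \<in> vec.span {e, f}" "f \<in> vec.span {e, f}" by (simp_all add: vec.span_base)
    ultimately show "x \<in> vec.span {e, f}" by (simp only: vec.span_add vec.span_scale)
  qed
  have orth: "g \<in> carrier (orth_group S)" using g(1) by (simp add: U1_rat_def O_plus_rat_def)
  have triv: "g *v x = x" if "bform S e x = 0" "bform S f x = 0" for x
  proof -
    have "x \<in> perp_rat S J"
      using that by (intro perp_rat_memI[OF span]) (auto simp: bform_commute[OF S, of x])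
    then show ?thesis using g(1) by (simp add: U1_rat_def)
  qed
  have not_multiple: "f \<noteq> c *s e" for c
  proof
    assume f: "f = c *s e"
    obtain p q where pq: "quotient_of c = (p, q)" by force
    have q: "q > 0" "c = of_int p / of_int q"
      using quotient_of_denom_pos[OF pq] quotient_of_div[OF pq] by auto
    have "of_int (- p) *s e + of_int q *s f = 0" using q by (simp add: f vec_eq_iff)
    then show False using indep q(1) by fastforce
  qed
  show ?thesis
  proof (rule disc_group_of_unipotent[OF S e iso(1) orth _ _ g(2,3,4)])
    show "g *v e = e" using triv iso by (simp add: bform_commute[OF S, of f e])
    show "\<forall>x. bform S e x = 0 \<longrightarrow> (\<exists>c. g *v x - x = c *s e)"
      using trivial_on_plane_perp[OF S orth e iso not_multiple triv] by blast
  qed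
qed

section \<open>Eichler transvections\<close>

text \<open>
  The Eichler transvection attached to an isotropic \<open>e\<close> and a vector \<open>u\<close> orthogonal to \<open>e\<close>.  It is
  defined over an arbitrary field since it is needed over \<open>\<rat>\<close> and, with real parameters, on
  \<open>L\<^sub>\<complex>\<close>.
\<close>

definition transvection :: "int ^ 'n ^ 'n \<Rightarrow> 'a::field ^ 'n \<Rightarrow> 'a ^ 'n \<Rightarrow> 'a ^ 'n \<Rightarrow> 'a ^ 'n" where
  "transvection S e u x =
     x - bform S u x *s e + bform S e x *s u - (bform S u u / 2 * bform S e x) *s e"

lemma linear_transvection: "Vector_Spaces.linear (*s) (*s) (transvection S e u)"
  by unfold_locales
    (simp_all add: transvection_def bform_simps vec_eq_iff algebra_simps)

lemma bform_transvection:
  fixes x y e u :: "'a::field_char_0 ^ 'n"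
  assumes S: "even_lattice S" and ee: "bform S e e = 0" and eu: "bform S e u = 0"
  shows "bform S (transvection S e u x) (transvection S e u y) = bform S x y"
  by (simp add: transvection_def bform_simps ee eu bform_commute[OF S, of u e]
      bform_commute[OF S, of x e] bform_commute[OF S, of x u] field_simps)

lemma bform_e_transvection:
  fixes x e u :: "'a::field_char_0 ^ 'n"
  assumes "bform S e e = 0" "bform S e u = 0"
  shows "bform S e (transvection S e u x) = bform S e x"
  using assms by (simp add: transvection_def bform_simps)

lemma transvection_inverse:
  fixes x e u :: "'a::field_char_0 ^ 'n"
  assumes S: "even_lattice S" and ee: "bform S e e = 0" and eu: "bform S e u = 0"
  shows "transvection S e (- u) (transvection S e u x) = x"
proof -
  have ue: "bform S u e = 0" using eu bform_commute[OF S] by metis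
  have u: "bform S u (transvection S e u x) = bform S u x + bform S e x * bform S u u"
    by (simp add: transvection_def bform_simps ue)
  show ?thesis
    by (simp add: transvection_def[of S e "- u"] bform_e_transvection[OF ee eu] bform_minus_left
        bform_minus_right u) (simp add: transvection_def vec_eq_iff field_simps)
qed

text \<open>
  A transvection \<open>T\<close> satisfies \<open>(T - 1)\<^sup>3 = 0\<close>, hence its inverse is a polynomial in \<open>T\<close> with
  integral coefficients.
\<close>

lemma transvection_uminus:
  fixes x e u :: "'a::field_char_0 ^ 'n"
  assumes S: "even_lattice S" and ee: "bform S e e = 0" and eu: "bform S e u = 0"
  shows "transvection S e (- u) x =
    transvection S e u (transvection S e u x) - 3 *s transvection S e u x + 3 *s x"
proof -
  have ue: "bform S u e = 0" using eu bform_commute[OF S] by metis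
  have u: "bform S u (transvection S e u x) = bform S u x + bform S e x * bform S u u"
    by (simp add: transvection_def bform_simps ue)
  show ?thesis
    by (simp add: transvection_def[of S e u "transvection S e u x"] bform_e_transvection[OF ee eu] u)
      (simp add: transvection_def vec_eq_iff bform_minus_left bform_minus_right field_simps)
qed

definition transvection_matrix :: "int ^ 'n ^ 'n \<Rightarrow> rat ^ 'n \<Rightarrow> rat ^ 'n \<Rightarrow> rat ^ 'n ^ 'n" where
  "transvection_matrix S e u = matrix (transvection S e u)"

lemma transvection_matrix_vector: "transvection_matrix S e u *v x = transvection S e u x"
  unfolding transvection_matrix_def by (rule matrix_works[OF linear_transvection])

lemma transvection_matrix_inverse:
  assumes "even_lattice S" "bform S e e = 0" "bform S e u = 0"
  shows "transvection_matrix S e (- u) ** transvection_matrix S e u = mat 1"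
    and "transvection_matrix S e u ** transvection_matrix S e (- u) = mat 1"
  using transvection_inverse[OF assms] transvection_inverse[OF assms(1,2), of "- u"] assms(3)
  by (simp_all add: matrix_eq transvection_matrix_vector bform_minus_right
      flip: matrix_vector_mul_assoc)

lemma transvection_matrix_orth:
  assumes "even_lattice S" "bform S e e = 0" "bform S e u = 0"
  shows "transvection_matrix S e u \<in> carrier (orth_group S)"
  using transvection_matrix_inverse[OF assms] bform_transvection[OF assms]
  by (auto simp: orth_group_def invertible_def transvection_matrix_vector)

definition of_rat_vec :: "rat ^ 'n \<Rightarrow> complex ^ 'n" where
  "of_rat_vec x = (\<chi> i. of_rat (x $ i))"

lemma bform_of_rat_vec: "bform S (of_rat_vec x) (of_rat_vec y) = of_rat (bform S x y)"
  by (simp add: bform_def of_rat_vec_def of_rat_sum of_rat_mult)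

lemma transvection_of_rat_vec:
  "transvection S (of_rat_vec e) (of_rat_vec u) (of_rat_vec x) = of_rat_vec (transvection S e u x)"
  by (simp add: transvection_def bform_of_rat_vec)
    (simp add: of_rat_vec_def vec_eq_iff of_rat_add of_rat_diff of_rat_mult of_rat_divide)

lemma complexify_transvection_matrix:
  "complexify (transvection_matrix S e u) *v w = transvection S (of_rat_vec e) (of_rat_vec u) w"
proof -
  have axis: "of_rat_vec (axis j 1) = axis j 1" for j :: 'a
    by (simp add: of_rat_vec_def axis_def vec_eq_iff)
  have "of_rat (transvection S e u (axis j 1) $ i) =
      transvection S (of_rat_vec e) (of_rat_vec u) (axis j 1) $ i" for i j
  proof -
    have "of_rat (transvection S e u (axis j 1) $ i) = of_rat_vec (transvection S e u (axis j 1)) $ i"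
      by (simp add: of_rat_vec_def)
    then show ?thesis by (simp only: axis flip: transvection_of_rat_vec)
  qed
  then have "complexify (transvection_matrix S e u) =
      matrix (transvection S (of_rat_vec e) (of_rat_vec u))"
    by (simp add: complexify_def transvection_matrix_def matrix_def vec_eq_iff)
  then show ?thesis by (simp add: matrix_works[OF linear_transvection])
qed

definition cnj_vec :: "complex ^ 'n \<Rightarrow> complex ^ 'n" where
  "cnj_vec w = (\<chi> i. cnj (w $ i))"

lemma cnj_bform: "cnj (bform S x y) = bform S (cnj_vec x) (cnj_vec y)"
  by (simp add: bform_def cnj_vec_def)

lemma cnj_of_rat: "cnj (of_rat r) = of_rat r"
proof (cases r)
  case (Fract a b)
  then show ?thesis by (simp add: of_rat_rat)
qed

lemma cnj_transvection:
  assumes "cnj_vec e = e" "cnj_vec u = u"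
  shows "cnj_vec (transvection S e u w) = transvection S e u (cnj_vec w)"
proof -
  have "bform S e (cnj_vec w) = cnj (bform S e w)" "bform S u (cnj_vec w) = cnj (bform S u w)"
    "cnj (bform S u u) = bform S u u"
    using assms by (simp_all add: cnj_bform)
  moreover have "cnj (e $ i) = e $ i" "cnj (u $ i) = u $ i" for i
    using assms by (metis cnj_vec_def vec_lambda_beta)+
  ultimately show ?thesis
    by (simp add: transvection_def cnj_vec_def vec_eq_iff)
qed

text \<open>
  Scaling \<open>u\<close> by \<open>t \<in> [0, 1]\<close> joins the identity to the transvection inside the real orthogonal
  group, so no point of the period domain is moved out of its component.
\<close>

lemma transvection_stays_in_component:
  assumes S: "even_lattice S" and ee: "bform S e e = 0" and eu: "bform S e u = 0"
    and D: "D \<in> period_components S"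
  shows "act_line (transvection_matrix S e u) ` D \<subseteq> D"
proof (rule image_subsetI)
  fix l assume l: "l \<in> D"
  obtain w where w: "l = cline w" "w \<noteq> 0" "bform S w w = 0"
    "bform S w (cnj_vec w) \<in> \<real>" "Re (bform S w (cnj_vec w)) > 0"
    using period_component_lines[OF D l] unfolding cnj_vec_def by metis
  let ?e = "of_rat_vec e" and ?u = "\<lambda>t::real. complex_of_real t *s of_rat_vec u"
  define G where "G t = transvection S ?e (?u t)" for t
  have ee': "bform S ?e ?e = 0" and eu': "bform S ?e (?u t) = 0" for t
    by (simp_all add: bform_of_rat_vec bform_scale_right ee eu)
  have real: "cnj_vec ?e = ?e" "cnj_vec (?u t) = ?u t" for t
    by (simp_all add: cnj_vec_def of_rat_vec_def vec_eq_iff cnj_of_rat)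
  note isom = bform_transvection[OF S ee' eu']
  have G_ne: "G t w \<noteq> 0" for t
  proof
    assume "G t w = 0"
    then have "w = transvection S ?e (- ?u t) 0"
      using transvection_inverse[OF S ee' eu', of t w] by (simp add: G_def)
    then show False using w(2) by (simp add: transvection_def)
  qed
  have G_dom: "cline (G t w) \<in> period_domain S" for t
  proof -
    have "bform S (G t w) (G t w) = 0" using w(3) by (simp add: G_def isom)
    moreover have "bform S (G t w) (\<chi> i. cnj (G t w $ i)) = bform S w (cnj_vec w)"
      unfolding cnj_vec_def[symmetric] G_def cnj_transvection[OF real] isom ..
    ultimately show ?thesis unfolding period_domain_def using w(4,5) G_ne[of t] by fastforce
  qed
  have cont: "continuous_on {0..1} (\<lambda>t. G t w)"
  proof -
    have "(\<lambda>t. G t w) = (\<lambda>t. \<chi> i. w $ i - of_real t * bform S (of_rat_vec u) w * ?e $ i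
        + bform S ?e w * (of_real t * of_rat_vec u $ i)
        - (of_real t * (of_real t * bform S (of_rat_vec u) (of_rat_vec u)) / 2 * bform S ?e w) * ?e $ i)"
      by (simp add: G_def transvection_def bform_scale_left bform_scale_right vec_eq_iff fun_eq_iff)
    then show ?thesis by (simp only:) (intro continuous_intros continuous_on_vec_lambda; simp)
  qed
  let ?X = "subtopology proj_space (period_domain S)"
  have "continuous_map (top_of_set {0..1}) (top_of_set (- {0})) (\<lambda>t. G t w)"
    using cont G_ne by (auto simp: continuous_map_in_subtopology)
  then have "continuous_map (top_of_set {0..1}) proj_space (cline \<circ> (\<lambda>t. G t w))"
    using quotient_imp_continuous_map[OF quotient_map_cline] by (rule continuous_map_compose)
  then have "continuous_map (top_of_set {0..1}) ?X (cline \<circ> (\<lambda>t. G t w))"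
    using G_dom by (simp add: continuous_map_in_subtopology)
  moreover have "connectedin (top_of_set {0..1}) {0..1::real}"
    by (simp add: connectedin_subtopology connected_Icc)
  ultimately have conn: "connectedin ?X ((cline \<circ> (\<lambda>t. G t w)) ` {0..1})"
    by (rule connectedin_continuous_map_image)
  have G0: "G 0 w = w" by (simp add: G_def transvection_def)
  have "l \<in> (cline \<circ> (\<lambda>t. G t w)) ` {0..1}"
    using G0 w(1) by (intro image_eqI[of _ _ 0]) auto
  then have "\<not> disjnt D ((cline \<circ> (\<lambda>t. G t w)) ` {0..1})" using l by (auto simp: disjnt_def)
  then have "(cline \<circ> (\<lambda>t. G t w)) ` {0..1} \<subseteq> D"
    using connected_components_of_maximal[OF _ conn] D by (simp add: period_components_def)
  then have "cline (G 1 w) \<in> D" by auto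
  moreover have "act_line (transvection_matrix S e u) l = cline (G 1 w)"
    by (simp add: w(1) act_line_cline complexify_transvection_matrix G_def)
  ultimately show "act_line (transvection_matrix S e u) l \<in> D" by simp
qed

lemma transvection_matrix_O_plus_rat:
  assumes S: "even_lattice S" and ee: "bform S e e = 0" and eu: "bform S e u = 0"
    and D: "D \<in> period_components S"
  shows "transvection_matrix S e u \<in> O_plus_rat S D"
proof -
  have eu': "bform S e (- u) = 0" using eu by (simp add: bform_minus_right)
  have "D = act_line (transvection_matrix S e u) ` act_line (transvection_matrix S e (- u)) ` D"
    by (simp add: image_image act_line_mat_1 transvection_matrix_inverse(2)[OF S ee eu]
        flip: act_line_mult)
  also have "\<dots> \<subseteq> act_line (transvection_matrix S e u) ` D"
    by (rule image_mono[OF transvection_stays_in_component[OF S ee eu' D]])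
  finally show ?thesis
    using transvection_stays_in_component[OF S ee eu D] transvection_matrix_orth[OF S ee eu]
    by (auto simp: O_plus_rat_def)
qed

text \<open>
  A transvection lies in the unipotent group of the cusp \<open>\<int>e\<close>.  If it acts as \<open>-1\<close> on the
  discriminant group, its negative is stable, so that it is the product of \<open>-1\<close> with a stable element.
\<close>

lemma irregular_cusp0_of_transvection:
  assumes S: "even_lattice S" and D: "D \<in> period_components S"
    and I: "cusp S 1 (range (\<lambda>n. of_int n *s e))" and eu: "bform S e u = 0"
    and integral: "\<And>x. x \<in> int_vecs \<Longrightarrow> transvection S e u x \<in> int_vecs"
    and minus_one: "\<And>x. x \<in> dual_lattice S \<Longrightarrow> transvection S e u x + x \<in> int_vecs"
    and nontrivial: "x \<in> dual_lattice S" "transvection S e u x - x \<notin> int_vecs"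
  shows "has_irregular_cusp0 S D (stable_O_plus S D)"
proof -
  let ?g = "transvection_matrix S e u" and ?\<Gamma> = "stable_O_plus S D"
    and ?I = "range (\<lambda>n. of_int n *s e)"
  interpret O: group "orth_group S" by (rule group_orth_group)
  have eI: "e \<in> ?I" by (rule range_eqI[of _ _ 1]) simp
  moreover have "\<forall>x\<in>?I. \<forall>y\<in>?I. bform S x y = 0"
    using I unfolding cusp_def by (elim conjE)
  ultimately have ee: "bform S e e = 0" by blast
  have ue: "bform S u e = 0" using eu bform_commute[OF S] by metis
  have O: "?g \<in> O_plus_rat S D" by (rule transvection_matrix_O_plus_rat[OF S ee eu D])
  have orth: "?g \<in> carrier (orth_group S)" using O by (simp add: O_plus_rat_def)
  have fix_e: "?g *v (of_int n *s e) = of_int n *s e" for n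
    by (simp add: transvection_matrix_vector transvection_def bform_scale_right ee ue)
  have gL: "(*v) ?g ` int_vecs = int_vecs"
  proof
    show "(*v) ?g ` int_vecs \<subseteq> int_vecs" using integral by (auto simp: transvection_matrix_vector)
    show "int_vecs \<subseteq> (*v) ?g ` int_vecs"
    proof
      fix x :: "rat ^ 'a" assume x: "x \<in> int_vecs"
      have "transvection S e (- u) x \<in> int_vecs"
        unfolding transvection_uminus[OF S ee eu]
        using x integral by (intro int_vecs_add int_vecs_diff int_vecs_scale) auto
      moreover have "x = ?g *v transvection S e (- u) x"
        using transvection_inverse[OF S ee, of "- u" x] eu
        by (simp add: transvection_matrix_vector bform_minus_right)
      ultimately show "x \<in> (*v) ?g ` int_vecs" by blast
    qed
  qed
  have U: "?g \<in> U0_rat S D ?I"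
  proof -
    have "?g *v x - x \<in> vec.span ?I" if "x \<in> perp_rat S ?I" for x
    proof -
      have "bform S x e = 0" using that vec.span_base[OF eI] by (simp add: perp_rat_def)
      then have "?g *v x - x = (- bform S u x) *s e"
        by (simp add: transvection_matrix_vector transvection_def bform_commute[OF S, of e] vec_eq_iff)
      then show ?thesis using vec.span_base[OF eI] vec.span_scale by metis
    qed
    moreover have "(*v) ?g ` ?I = ?I" by (simp add: image_image fix_e)
    ultimately show ?thesis using O by (auto simp: U0_rat_def fix_e)
  qed
  have "?g \<notin> ?\<Gamma>" using nontrivial by (auto simp: stable_O_plus_def transvection_matrix_vector)
  have "- ?g \<in> ?\<Gamma>"
  proof -
    have "act_line (- ?g) ` D = D" using O act_line_minus[OF D] by (simp add: O_plus_rat_def)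
    moreover have "(*v) (- ?g) ` int_vecs = uminus ` ((*v) ?g ` int_vecs)"
      by (simp add: image_image minus_matrix_vector)
    then have "(*v) (- ?g) ` int_vecs = int_vecs" by (simp only: gL image_uminus_int_vecs)
    moreover have "(- ?g) *v x - x \<in> int_vecs" if "x \<in> dual_lattice S" for x
    proof -
      have "(- ?g) *v x - x = - (transvection S e u x + x)"
        by (simp add: minus_matrix_vector transvection_matrix_vector)
      then show ?thesis using int_vecs_minus[OF minus_one[OF that]] by simp
    qed
    ultimately show ?thesis
      using minus_in_orth_group[OF orth] by (simp add: stable_O_plus_def O_plus_def O_plus_rat_def)
  qed
  then have "(- mat 1) \<otimes>\<^bsub>orth_group S\<^esub> (- ?g) \<in> with_neg_id S ?\<Gamma>"
    unfolding with_neg_id_def by (intro generate.eng generate.incl) auto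
  moreover have "(- mat 1) \<otimes>\<^bsub>orth_group S\<^esub> (- ?g) = ?g"
    by (simp add: orth_group_def matrix_eq minus_matrix_vector flip: matrix_vector_mul_assoc)
  ultimately have "?g \<in> with_neg_id S ?\<Gamma>" by simp
  with U \<open>?g \<notin> ?\<Gamma>\<close> I show ?thesis unfolding has_irregular_cusp0_def by blast
qed

section \<open>Transport along isometries of lattices\<close>

lemma additive_imp_matrix:
  fixes h :: "int ^ 'm \<Rightarrow> int ^ 'k"
  assumes add: "\<And>x y. h (x + y) = h x + h y"
  shows "\<exists>P :: rat ^ 'm ^ 'k. \<forall>z. P *v of_int_vec z = of_int_vec (h z)"
proof -
  have o_add: "of_int_vec (x + y) = (of_int_vec x + of_int_vec y :: rat ^ 'k)" for x y
    by (simp add: of_int_vec_def vec_eq_iff)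
  have h0: "h 0 = 0" using add[of 0 0] by simp
  have scale: "of_int_vec (h (c *s x)) = (of_int c *s of_int_vec (h x) :: rat ^ 'k)" for c x
    using additive_int_imp_scale[of "\<lambda>c. of_int_vec (h (c *s x))" c]
    by (simp add: vector_sadd_rdistrib add o_add)
  have "of_int_vec (h (\<Sum>j\<in>A. z $ j *s axis j 1)) =
      (\<Sum>j\<in>A. of_int (z $ j) *s of_int_vec (h (axis j 1)) :: rat ^ 'k)" for z A
    by (induction A rule: infinite_finite_induct) (simp_all add: h0 add o_add scale, simp_all add: of_int_vec_def vec_eq_iff)
  then have expand: "(\<Sum>j\<in>UNIV. of_int (z $ j) *s of_int_vec (h (axis j 1))) = (of_int_vec (h z) :: rat ^ 'k)"
    for z using basis_expansion[of z] by metis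
  have "((\<chi> i j. of_int (h (axis j 1) $ i)) :: rat ^ 'm ^ 'k) *v of_int_vec z = of_int_vec (h z)" for z
    unfolding expand[of z, symmetric]
    by (simp add: matrix_vector_mult_def of_int_vec_def vec_eq_iff mult.commute)
  then show ?thesis by blast
qed

text \<open>
  An isometry of lattices extends to the rational spaces.  The identities for the extension hold on
  integral vectors and follow for rational ones by clearing denominators.
\<close>

lemma lattice_iso_matrices:
  fixes S :: "int ^ 'n ^ 'n" and T :: "int ^ 't ^ 't"
  assumes "S \<simeq>\<^sub>L T"
  shows "\<exists>(P :: rat ^ 'n ^ 't) (Q :: rat ^ 't ^ 'n).
    (\<forall>x. Q *v (P *v x) = x) \<and> (\<forall>y. P *v (Q *v y) = y) \<and>
    (\<forall>x\<in>int_vecs. P *v x \<in> int_vecs) \<and> (\<forall>y\<in>int_vecs. Q *v y \<in> int_vecs) \<and>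
    (\<forall>x y. bform T (P *v x) (P *v y) = bform S x y)"
proof -
  obtain f :: "int ^ 'n \<Rightarrow> int ^ 't" where bij: "bij f" and add: "\<And>x y. f (x + y) = f x + f y"
    and isom: "\<And>x y. bform T (f x) (f y) = bform S x y"
    using assms unfolding lattice_iso_def by blast
  define g where "g = inv_into UNIV f"
  have inv_f: "g (f x) = x" "f (g y) = y" for x y
    using bij by (simp_all add: g_def bij_is_inj bij_is_surj surj_f_inv_f)
  have inv_add: "g (x + y) = g x + g y" for x y
    using add[of "g x" "g y"] inv_f by metis
  obtain P :: "rat ^ 'n ^ 't" where P: "\<And>z. P *v of_int_vec z = of_int_vec (f z)"
    using additive_imp_matrix[of f] add by blast
  obtain Q :: "rat ^ 't ^ 'n" where Q: "\<And>z. Q *v of_int_vec z = of_int_vec (g z)"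
    using additive_imp_matrix[of g] inv_add by blast
  have "Q *v (P *v x) = x" for x
  proof -
    obtain k :: int where k: "k > 0" "of_int k *s x \<in> int_vecs" by (rule clear_denominators)
    then obtain z where z: "of_int k *s x = of_int_vec z" by (auto simp: int_vecs_eq_range)
    have "of_int k *s (Q *v (P *v x)) = Q *v (P *v of_int_vec z)" by (simp add: vec.scale flip: z)
    also have "\<dots> = of_int k *s x" by (simp add: P Q inv_f z)
    finally show ?thesis using k(1) by (simp add: vec_eq_iff)
  qed
  moreover have "P *v (Q *v y) = y" for y
  proof -
    obtain k :: int where k: "k > 0" "of_int k *s y \<in> int_vecs" by (rule clear_denominators)
    then obtain z where z: "of_int k *s y = of_int_vec z" by (auto simp: int_vecs_eq_range)
    have "of_int k *s (P *v (Q *v y)) = P *v (Q *v of_int_vec z)" by (simp add: vec.scale flip: z)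
    also have "\<dots> = of_int k *s y" by (simp add: P Q inv_f z)
    finally show ?thesis using k(1) by (simp add: vec_eq_iff)
  qed
  moreover have "bform T (P *v x) (P *v y) = bform S x y" for x y
  proof -
    obtain k :: int where k: "k > 0" "of_int k *s x \<in> int_vecs" by (rule clear_denominators)
    then obtain v where v: "of_int k *s x = of_int_vec v" by (auto simp: int_vecs_eq_range)
    obtain l :: int where l: "l > 0" "of_int l *s y \<in> int_vecs" by (rule clear_denominators)
    then obtain w where w: "of_int l *s y = of_int_vec w" by (auto simp: int_vecs_eq_range)
    have "of_int k * (of_int l * bform T (P *v x) (P *v y)) =
        bform T (P *v (of_int k *s x)) (P *v (of_int l *s y))"
      by (simp add: vec.scale bform_scale_left bform_scale_right)
    also have "\<dots> = bform S (of_int k *s x) (of_int l *s y)"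
      by (simp add: v w P bform_of_int_vec isom)
    also have "\<dots> = of_int k * (of_int l * bform S x y)"
      by (simp add: bform_scale_left bform_scale_right)
    finally show ?thesis using k(1) l(1) by simp
  qed
  moreover have "P *v x \<in> int_vecs" if "x \<in> int_vecs" for x
    using that by (auto simp: int_vecs_eq_range P)
  moreover have "Q *v y \<in> int_vecs" if "y \<in> int_vecs" for y
    using that by (auto simp: int_vecs_eq_range Q)
  ultimately show ?thesis by blast
qed

text \<open>
  In the coordinates provided by \<open>P\<close>, the vector \<open>c\<close> has an entry 1 at \<open>i\<^sub>0\<close>.  Subtracting the
  multiple of \<open>c\<close> that clears this entry and keeping the other entries identifies the quotient by
  \<open>\<int>c\<close> with a free group.
\<close>

lemma cusp_of_unit_coordinate:
  fixes S :: "int ^ 'n ^ 'n" and P :: "rat ^ 'n ^ 't" and Q :: "rat ^ 't ^ 'n"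
  assumes QP: "\<And>x. Q *v (P *v x) = x" and PQ: "\<And>y. P *v (Q *v y) = y"
    and P: "\<And>x. x \<in> int_vecs \<Longrightarrow> P *v x \<in> int_vecs" and Q: "\<And>y. y \<in> int_vecs \<Longrightarrow> Q *v y \<in> int_vecs"
    and c: "c \<in> int_vecs" "c $ i0 = 1" and iso: "bform S (Q *v c) (Q *v c) = 0"
  shows "cusp S 1 (range (\<lambda>n. of_int n *s (Q *v c)))"
proof -
  let ?L = "add_group int_vecs :: (rat ^ 'n) monoid"
  define e where "e = Q *v c"
  let ?I = "range (\<lambda>n. of_int n *s e)"
  have eL: "e \<in> int_vecs" using c(1) Q by (simp add: e_def)
  have Pe: "P *v e = c" by (simp add: e_def PQ)
  have e0: "e \<noteq> 0"
  proof
    assume "e = 0"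
    then have "c = 0" using Pe by simp
    then show False using c(2) by simp
  qed
  interpret L: comm_group ?L by (rule comm_group_int_vecs)
  have sub: "subgroup ?I ?L"
  proof (rule L.subgroupI)
    show "?I \<subseteq> carrier ?L" using eL by (auto intro: int_vecs_scale)
    show "?I \<noteq> {}" by blast
  next
    fix x assume "x \<in> ?I"
    then obtain n where n: "x = of_int n *s e" by blast
    have "inv\<^bsub>?L\<^esub> x = of_int (- n) *s e"
      using eL by (intro L.inv_equality) (auto simp: n intro!: int_vecs_scale int_vecs_minus)
    then show "inv\<^bsub>?L\<^esub> x \<in> ?I" by blast
  next
    fix x y assume "x \<in> ?I" "y \<in> ?I"
    then obtain m n where "x = of_int m *s e" "y = of_int n *s e" by blast
    then have "x \<otimes>\<^bsub>?L\<^esub> y = of_int (m + n) *s e" by (simp add: vector_sadd_rdistrib)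
    then show "x \<otimes>\<^bsub>?L\<^esub> y \<in> ?I" by blast
  qed
  have rank: "add_group ?I \<cong> group_power integer_group 1"
  proof -
    let ?\<phi> = "\<lambda>f :: nat \<Rightarrow> int. of_int (f 0) *s e"
    have "?\<phi> \<in> iso (group_power integer_group 1) (add_group ?I)"
      unfolding iso_def bij_betw_def
    proof (intro CollectI conjI)
      show "?\<phi> \<in> hom (group_power integer_group 1) (add_group ?I)"
        by (rule homI) (auto simp: vector_sadd_rdistrib)
      show "inj_on ?\<phi> (carrier (group_power integer_group 1))"
      proof (rule inj_onI)
        fix f f' assume f: "f \<in> carrier (group_power integer_group 1)"
          "f' \<in> carrier (group_power integer_group 1)" and "?\<phi> f = ?\<phi> f'"
        then have "f 0 = f' 0" using e0 by (simp add: vec.scale_right_imp_eq)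
        then show "f = f'" using f by (intro PiE_ext[of f "{..<1}" _ f']) auto
      qed
      show "?\<phi> ` carrier (group_power integer_group 1) = carrier (add_group ?I)"
      proof
        show "carrier (add_group ?I) \<subseteq> ?\<phi> ` carrier (group_power integer_group 1)"
        proof
          fix x assume "x \<in> carrier (add_group ?I)"
          then obtain n where "x = of_int n *s e" by auto
          then show "x \<in> ?\<phi> ` carrier (group_power integer_group 1)"
            by (intro image_eqI[of _ _ "\<lambda>i\<in>{..<1}. n"]) auto
        qed
      qed auto
    qed
    then have "group_power integer_group 1 \<cong> add_group ?I" by (rule is_isoI)
    then show ?thesis using group.iso_sym[OF group_group_power[OF group_integer_group]] by blast
  qed
  define k where "k = card (UNIV - {i0})"
  obtain \<sigma> where \<sigma>: "bij_betw \<sigma> {..<k} (UNIV - {i0})"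
    using ex_bij_betw_nat_finite[of "UNIV - {i0}"] by (auto simp: k_def atLeast0LessThan)
  define r where "r x i = (P *v x) $ i - (P *v x) $ i0 * c $ i" for x i
  have r_int: "r x i \<in> \<int>" if "x \<in> int_vecs" for x i
    using P[OF that] c(1) by (auto simp: r_def int_vecs_def)
  have r_floor: "of_int \<lfloor>r x i\<rfloor> = r x i" if "x \<in> int_vecs" for x i
    using r_int[OF that] by simp
  have r_add: "r (x + y) i = r x i + r y i" for x y i
    by (simp add: r_def matrix_vector_right_distrib algebra_simps)
  define h where "h x = (\<lambda>j\<in>{..<k}. \<lfloor>r x (\<sigma> j)\<rfloor>)" for x
  have hom: "h \<in> hom ?L (group_power integer_group k)"
  proof (rule homI)
    fix x y assume xy: "x \<in> carrier ?L" "y \<in> carrier ?L"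
    have "\<lfloor>r (x + y) i\<rfloor> = \<lfloor>r x i\<rfloor> + \<lfloor>r y i\<rfloor>" for i
    proof -
      obtain m where "r x i = of_int m" using r_int[of x i] xy by (auto elim: Ints_cases)
      then show ?thesis by (simp add: r_add)
    qed
    then show "h (x \<otimes>\<^bsub>?L\<^esub> y) = h x \<otimes>\<^bsub>group_power integer_group k\<^esub> h y"
      by (auto simp: h_def)
  qed (auto simp: h_def)
  interpret h: group_hom ?L "group_power integer_group k" h
    using hom by (simp add: group_hom_def group_hom_axioms_def group_group_power)
  have kernel: "kernel ?L (group_power integer_group k) h = ?I"
  proof
    show "?I \<subseteq> kernel ?L (group_power integer_group k) h"
    proof
      fix x assume "x \<in> ?I"
      then obtain n where n: "x = of_int n *s e" by blast
      have "r x i = 0" for i by (simp add: r_def n vec.scale Pe c(2))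
      then show "x \<in> kernel ?L (group_power integer_group k) h"
        using eL by (auto simp: kernel_def n h_def group_power_def int_vecs_scale)
    qed
    show "kernel ?L (group_power integer_group k) h \<subseteq> ?I"
    proof
      fix x assume "x \<in> kernel ?L (group_power integer_group k) h"
      then have x: "x \<in> int_vecs" and "h x = (\<lambda>j\<in>{..<k}. 0)"
        by (auto simp: kernel_def group_power_def)
      then have *: "\<lfloor>r x (\<sigma> j)\<rfloor> = 0" if "j < k" for j
        using that by (metis h_def lessThan_iff restrict_apply')
      have "r x i = 0" for i
      proof (cases "i = i0")
        case True
        then show ?thesis by (simp add: r_def c(2))
      next
        case False
        then obtain j where "j < k" "i = \<sigma> j" using \<sigma> by (auto simp: bij_betw_def)
        then show ?thesis using * r_floor[OF x, of i] by simp
      qed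
      then have "(P *v x) $ i = ((P *v x) $ i0 *s c) $ i" for i
        by (metis eq_iff_diff_eq_0 r_def vector_smult_component)
      then have "P *v x = (P *v x) $ i0 *s c" using vec_eq_iff by blast
      moreover obtain n where "(P *v x) $ i0 = of_int n"
        using P[OF x] by (auto simp: int_vecs_def Ints_def)
      ultimately have "Q *v (P *v x) = of_int n *s e" by (metis e_def vec.scale)
      then show "x \<in> ?I" by (auto simp: QP)
    qed
  qed
  have surj: "h ` carrier ?L = carrier (group_power integer_group k)"
  proof
    show "h ` carrier ?L \<subseteq> carrier (group_power integer_group k)" using h.hom_closed by blast
    show "carrier (group_power integer_group k) \<subseteq> h ` carrier ?L"
    proof
      fix f assume f: "f \<in> carrier (group_power integer_group k)"
      let ?y = "(\<chi> i. if i = i0 then 0 else of_int (f (the_inv_into {..<k} \<sigma> i))) :: rat ^ 't"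
      have y: "?y \<in> int_vecs" by (simp add: int_vecs_def)
      have "h (Q *v ?y) j = f j" for j
      proof (cases "j < k")
        case True
        then have "\<sigma> j \<noteq> i0" using \<sigma> by (auto simp: bij_betw_def)
        moreover have "the_inv_into {..<k} \<sigma> (\<sigma> j) = j"
          using \<sigma> True by (auto simp: bij_betw_def intro: the_inv_into_f_f)
        ultimately show ?thesis using True by (simp add: h_def r_def PQ)
      next
        case False
        then show ?thesis using f by (auto simp: h_def PiE_iff extensional_def)
      qed
      then have "f = h (Q *v ?y)" by auto
      then show "f \<in> h ` carrier ?L" using Q[OF y] by auto
    qed
  qed
  have "?L Mod ?I \<cong> group_power integer_group k"
    using h.FactGroup_iso_set[OF surj] unfolding kernel by (rule is_isoI)
  moreover have "bform S x y = 0" if "x \<in> ?I" "y \<in> ?I" for x y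
    using that iso by (auto simp: bform_scale_left bform_scale_right e_def)
  ultimately show ?thesis
    using sub rank unfolding cusp_def e_def[symmetric] by blast
qed

text \<open>
  All conditions on the transvection can be checked in an isometric model \<open>T\<close> of the lattice.
\<close>

lemma irregular_cusp0_of_isometric_transvection:
  fixes S :: "int ^ 'n ^ 'n" and T :: "int ^ 't ^ 't"
  assumes S: "even_lattice S" and D: "D \<in> period_components S" and ST: "S \<simeq>\<^sub>L T"
    and e: "e \<in> int_vecs" "e $ i0 = 1" "bform T e e = 0" and eu: "bform T e u = 0"
    and integral: "\<And>x. x \<in> int_vecs \<Longrightarrow> transvection T e u x \<in> int_vecs"
    and minus_one: "\<And>x. x \<in> dual_lattice T \<Longrightarrow> transvection T e u x + x \<in> int_vecs"
    and nontrivial: "x \<in> dual_lattice T" "transvection T e u x - x \<notin> int_vecs"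
  shows "has_irregular_cusp0 S D (stable_O_plus S D)"
proof -
  obtain P :: "rat ^ 'n ^ 't" and Q :: "rat ^ 't ^ 'n"
    where QP: "\<And>x. Q *v (P *v x) = x" and PQ: "\<And>y. P *v (Q *v y) = y"
    and P: "\<And>x. x \<in> int_vecs \<Longrightarrow> P *v x \<in> int_vecs" and Q: "\<And>y. y \<in> int_vecs \<Longrightarrow> Q *v y \<in> int_vecs"
    and isom: "\<And>x y. bform T (P *v x) (P *v y) = bform S x y"
    using lattice_iso_matrices[OF ST] by blast
  have isom': "bform S (Q *v x) y = bform T x (P *v y)" "bform S y (Q *v x) = bform T (P *v y) x" for x y
    by (simp_all add: PQ flip: isom)
  have transv: "transvection S (Q *v e) (Q *v u) x = Q *v transvection T e u (P *v x)" for x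
    by (simp add: transvection_def isom' PQ QP matrix_vector_right_distrib
        matrix_vector_mult_diff_distrib vec.scale)
  have dual_P: "P *v x \<in> dual_lattice T" if "x \<in> dual_lattice S" for x
    using that Q by (auto simp: dual_lattice_def simp flip: isom')
  have dual_Q: "Q *v x \<in> dual_lattice S" if "x \<in> dual_lattice T" for x
    using that P by (auto simp: dual_lattice_def isom')
  show ?thesis
  proof (rule irregular_cusp0_of_transvection[OF S D])
    show "cusp S 1 (range (\<lambda>n. of_int n *s (Q *v e)))"
      by (rule cusp_of_unit_coordinate[OF QP PQ P Q e(1,2)]) (simp_all add: isom' PQ e(3))
    show "bform S (Q *v e) (Q *v u) = 0" by (simp add: isom' PQ eu)
    show "transvection S (Q *v e) (Q *v u) x \<in> int_vecs" if "x \<in> int_vecs" for x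
      unfolding transv using integral P Q that by blast
    show "transvection S (Q *v e) (Q *v u) x + x \<in> int_vecs" if "x \<in> dual_lattice S" for x
    proof -
      have "transvection S (Q *v e) (Q *v u) x + x = Q *v (transvection T e u (P *v x) + P *v x)"
        by (simp add: transv matrix_vector_right_distrib QP)
      then show ?thesis using minus_one[OF dual_P[OF that]] Q by simp
    qed
    show "Q *v x \<in> dual_lattice S" by (rule dual_Q[OF nontrivial(1)])
    show "transvection S (Q *v e) (Q *v u) (Q *v x) - Q *v x \<notin> int_vecs"
    proof
      assume "transvection S (Q *v e) (Q *v u) (Q *v x) - Q *v x \<in> int_vecs"
      then have "P *v (Q *v (transvection T e u x - x)) \<in> int_vecs"
        by (intro P) (simp add: transv PQ matrix_vector_mult_diff_distrib)
      then show False using nontrivial(2) by (simp add: PQ)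
    qed
  qed
qed

section \<open>The two families of lattices\<close>

definition join_vec :: "rat ^ 'n \<Rightarrow> rat ^ 'm \<Rightarrow> rat ^ ('n + 'm)" where
  "join_vec v w = (\<chi> i. case i of Inl a \<Rightarrow> v $ a | Inr b \<Rightarrow> w $ b)"

lemma join_vec_exhaust:
  obtains v w where "x = join_vec v w"
proof
  show "x = join_vec (\<chi> a. x $ Inl a) (\<chi> b. x $ Inr b)"
    by (simp add: join_vec_def vec_eq_iff split: sum.split)
qed

lemma join_vec_nth [simp]: "join_vec v w $ Inl a = v $ a" "join_vec v w $ Inr b = w $ b"
  by (simp_all add: join_vec_def)

lemma join_vec_eq_iff [simp]: "join_vec v w = join_vec v' w' \<longleftrightarrow> v = v' \<and> w = w'"
proof
  assume "join_vec v w = join_vec v' w'"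
  then have "join_vec v w $ Inl a = join_vec v' w' $ Inl a"
    "join_vec v w $ Inr b = join_vec v' w' $ Inr b" for a b by simp_all
  then show "v = v' \<and> w = w'" by (simp add: vec_eq_iff)
qed simp

lemma join_vec_arith [simp]:
  "join_vec v w + join_vec v' w' = join_vec (v + v') (w + w')"
  "join_vec v w - join_vec v' w' = join_vec (v - v') (w - w')"
  "c *s join_vec v w = join_vec (c *s v) (c *s w)"
  by (simp_all add: join_vec_def vec_eq_iff split: sum.split)

lemma bform_join_vec [simp]:
  "bform (S \<oplus>\<^sub>L T) (join_vec v w) (join_vec v' w') = bform S v v' + bform T w w'"
proof -
  have split: "(\<Sum>i\<in>UNIV. F i) = (\<Sum>a\<in>UNIV. F (Inl a)) + (\<Sum>b\<in>UNIV. F (Inr b))"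
    for F :: "'a + 'b \<Rightarrow> rat"
    by (simp add: UNIV_Plus_UNIV[symmetric] sum.Plus del: UNIV_Plus_UNIV)
  show ?thesis
    by (simp add: bform_def split orth_sum_def)
qed

lemma join_vec_int_vecs [simp]: "join_vec v w \<in> int_vecs \<longleftrightarrow> v \<in> int_vecs \<and> w \<in> int_vecs"
proof -
  have "(\<forall>i. join_vec v w $ i \<in> \<int>) \<longleftrightarrow> (\<forall>a. v $ a \<in> \<int>) \<and> (\<forall>b. w $ b \<in> \<int>)"
    by (metis join_vec_nth sum.exhaust)
  then show ?thesis by (simp add: int_vecs_def)
qed

lemma join_vec_dual_lattice [simp]:
  "join_vec v w \<in> dual_lattice (S \<oplus>\<^sub>L T) \<longleftrightarrow> v \<in> dual_lattice S \<and> w \<in> dual_lattice T"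
proof
  assume x: "join_vec v w \<in> dual_lattice (S \<oplus>\<^sub>L T)"
  have "bform S v y \<in> \<int>" if "y \<in> int_vecs" for y
    using bform_dual_int[OF x, of "join_vec y 0"] that by simp
  moreover have "bform T w y \<in> \<int>" if "y \<in> int_vecs" for y
    using bform_dual_int[OF x, of "join_vec 0 y"] that by simp
  ultimately show "v \<in> dual_lattice S \<and> w \<in> dual_lattice T" by (simp add: dual_lattice_def)
next
  assume vw: "v \<in> dual_lattice S \<and> w \<in> dual_lattice T"
  show "join_vec v w \<in> dual_lattice (S \<oplus>\<^sub>L T)"
    unfolding dual_lattice_def
  proof (intro CollectI ballI)
    fix y :: "rat ^ ('a + 'b)" assume y: "y \<in> int_vecs"
    obtain v' w' where y': "y = join_vec v' w'" by (rule join_vec_exhaust)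
    show "bform (S \<oplus>\<^sub>L T) (join_vec v w) y \<in> \<int>"
      using vw y by (simp add: y' bform_dual_int)
  qed
qed

definition vec2 :: "rat \<Rightarrow> rat \<Rightarrow> rat ^ 2" where
  "vec2 a b = (\<chi> i. if i = 1 then a else b)"

lemma vec2_exhaust:
  obtains a b where "x = vec2 a b"
proof
  show "x = vec2 (x $ 1) (x $ 2)" by (simp add: vec2_def vec_eq_iff forall_2)
qed

lemma vec2_simps [simp]:
  "vec2 a b = vec2 a' b' \<longleftrightarrow> a = a' \<and> b = b'"
  "vec2 a b + vec2 a' b' = vec2 (a + a') (b + b')"
  "vec2 a b - vec2 a' b' = vec2 (a - a') (b - b')"
  "c *s vec2 a b = vec2 (c * a) (c * b)"
  "bform lattice_U (vec2 a b) (vec2 a' b') = a * b' + b * a'"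
  "vec2 a b \<in> int_vecs \<longleftrightarrow> a \<in> \<int> \<and> b \<in> \<int>"
  by (simp_all add: vec2_def vec_eq_iff forall_2 bform_def lattice_U_def sum_2 int_vecs_def)

lemma vec2_dual_lattice [simp]:
  "vec2 a b \<in> dual_lattice lattice_U \<longleftrightarrow> a \<in> \<int> \<and> b \<in> \<int>"
proof
  assume x: "vec2 a b \<in> dual_lattice lattice_U"
  show "a \<in> \<int> \<and> b \<in> \<int>"
    using bform_dual_int[OF x, of "vec2 0 1"] bform_dual_int[OF x, of "vec2 1 0"] by simp
next
  assume "a \<in> \<int> \<and> b \<in> \<int>"
  then have "vec2 a b \<in> int_vecs" by simp
  then show "vec2 a b \<in> dual_lattice lattice_U" using int_vecs_subset_dual_lattice by blast
qed

definition vec1 :: "rat \<Rightarrow> rat ^ 1" where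
  "vec1 s = (\<chi> i. s)"

lemma vec1_exhaust:
  obtains s where "x = vec1 s"
proof
  show "x = vec1 (x $ 1)" by (simp add: vec1_def vec_eq_iff)
qed

lemma vec1_simps [simp]:
  "vec1 s = vec1 s' \<longleftrightarrow> s = s'"
  "vec1 s + vec1 s' = vec1 (s + s')"
  "vec1 s - vec1 s' = vec1 (s - s')"
  "c *s vec1 s = vec1 (c * s)"
  "vec1 s $ i = s"
  "bform (rank_one n) (vec1 s) (vec1 s') = of_int n * s * s'"
  "vec1 s \<in> int_vecs \<longleftrightarrow> s \<in> \<int>"
  by (simp_all add: vec1_def vec_eq_iff bform_def rank_one_def int_vecs_def)

lemma vec1_dual_lattice [simp]: "vec1 s \<in> dual_lattice (rank_one n) \<longleftrightarrow> of_int n * s \<in> \<int>"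
proof
  assume x: "vec1 s \<in> dual_lattice (rank_one n)"
  show "of_int n * s \<in> \<int>" using bform_dual_int[OF x, of "vec1 1"] by simp
next
  assume s: "of_int n * s \<in> \<int>"
  show "vec1 s \<in> dual_lattice (rank_one n)"
    unfolding dual_lattice_def
  proof (intro CollectI ballI)
    fix y :: "rat ^ 1" assume y: "y \<in> int_vecs"
    obtain s' where "y = vec1 s'" by (rule vec1_exhaust)
    then show "bform (rank_one n) (vec1 s) y \<in> \<int>" using s y by simp
  qed
qed

text \<open>
  Write \<open>v\<close> for the generator of norm \<open>-8\<close>.  The choice \<open>e = 2 e\<^sub>0 + 2 f\<^sub>0 + v\<close> is dictated by the
  requirement that \<open>e/2\<close> lie in the dual lattice and represent \<open>4 (v/8)\<close>; then \<open>u\<close> has to be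
  congruent to \<open>v/4 = -2 (-v/8)\<close> and orthogonal to \<open>e\<close>, which \<open>u = e\<^sub>0 + v/4\<close> achieves.
\<close>

lemma irregular_cusp0_U_8:
  fixes S :: "int ^ 'n ^ 'n" and M :: "int ^ 'm ^ 'm"
  assumes S: "even_lattice S" and D: "D \<in> period_components S"
    and M: "two_elementary (disc_group M)"
    and ST: "S \<simeq>\<^sub>L lattice_U \<oplus>\<^sub>L rank_one (-8) \<oplus>\<^sub>L M"
  shows "has_irregular_cusp0 S D (stable_O_plus S D)"
proof -
  let ?T = "lattice_U \<oplus>\<^sub>L rank_one (-8) \<oplus>\<^sub>L M"
  let ?v = "\<lambda>a b s m. join_vec (vec2 a b) (join_vec (vec1 s) m)"
  let ?e = "?v 2 2 1 0" and ?u = "?v 1 0 (1 / 4) 0"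
  have exhaust: "\<exists>a b s m. x = ?v a b s m" for x
    by (metis join_vec_exhaust vec2_exhaust vec1_exhaust)
  have transv: "transvection ?T ?e ?u (?v a b s m) = ?v (4 * a + b - 8 * s) a (a - s) m" for a b s m
    by (simp add: transvection_def field_simps)
  have M2: "m + m \<in> int_vecs" if "m \<in> dual_lattice M" for m
  proof -
    have "m + m = 2 *s m" by (simp add: vec_eq_iff)
    then show ?thesis using M that by (simp add: two_elementary_disc_group_iff)
  qed
  show ?thesis
  proof (rule irregular_cusp0_of_isometric_transvection[OF S D ST])
    show "?e \<in> int_vecs" by simp
    show "?e $ Inr (Inl 1) = 1" by simp
    show "bform ?T ?e ?e = 0" "bform ?T ?e ?u = 0" by simp_all
    show "transvection ?T ?e ?u x \<in> int_vecs" if x: "x \<in> int_vecs" for x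
    proof -
      obtain a b s m where "x = ?v a b s m" using exhaust by blast
      then show ?thesis using x by (simp add: transv)
    qed
    show "transvection ?T ?e ?u x + x \<in> int_vecs" if x: "x \<in> dual_lattice ?T" for x
    proof -
      obtain a b s m where x': "x = ?v a b s m" using exhaust by blast
      have "transvection ?T ?e ?u x + x = ?v (5 * a + b - 8 * s) (a + b) a (m + m)"
        by (simp add: x' transv)
      then show ?thesis using x M2 by (simp add: x')
    qed
    show "?v 0 0 (1 / 8) 0 \<in> dual_lattice ?T" by simp
    show "transvection ?T ?e ?u (?v 0 0 (1 / 8) 0) - ?v 0 0 (1 / 8) 0 \<notin> int_vecs"
      by (simp add: transv)
  qed
qed

text \<open>
  Write \<open>v\<^sub>1\<close>, \<open>v\<^sub>2\<close> for the generators of norm \<open>-4\<close>.  For \<open>e = 2 e\<^sub>0 + 2 f\<^sub>0 + v\<^sub>1 + v\<^sub>2\<close> the class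
  of \<open>e/2\<close> is the double of \<open>(v\<^sub>1 + v\<^sub>2)/4\<close>, and \<open>(e, y) = 1\<close> for \<open>y = - v\<^sub>1/4\<close>.  The vector
  \<open>u = e\<^sub>0 + v\<^sub>1/2\<close> is congruent to \<open>-2 y\<close>, orthogonal to \<open>e\<close> and of integral norm \<open>-1\<close>.
\<close>

lemma irregular_cusp0_U_4_4:
  fixes S :: "int ^ 'n ^ 'n" and M :: "int ^ 'm ^ 'm"
  assumes S: "even_lattice S" and D: "D \<in> period_components S"
    and M: "two_elementary (disc_group M)"
    and ST: "S \<simeq>\<^sub>L lattice_U \<oplus>\<^sub>L rank_one (-4) \<oplus>\<^sub>L rank_one (-4) \<oplus>\<^sub>L M"
  shows "has_irregular_cusp0 S D (stable_O_plus S D)"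
proof -
  let ?T = "lattice_U \<oplus>\<^sub>L rank_one (-4) \<oplus>\<^sub>L rank_one (-4) \<oplus>\<^sub>L M"
  let ?v = "\<lambda>a b s t m. join_vec (vec2 a b) (join_vec (vec1 s) (join_vec (vec1 t) m))"
  let ?e = "?v 2 2 1 1 0" and ?u = "?v 1 0 (1 / 2) 0 0"
  have exhaust: "\<exists>a b s t m. x = ?v a b s t m" for x
    by (metis join_vec_exhaust vec2_exhaust vec1_exhaust)
  have transv: "transvection ?T ?e ?u (?v a b s t m) =
      ?v (5 * a + 2 * b - 4 * s - 8 * t) (2 * a + b - 4 * t) (2 * a + b - s - 4 * t) (a - t) m"
    for a b s t m
    by (simp add: transvection_def field_simps)
  have M2: "m + m \<in> int_vecs" if "m \<in> dual_lattice M" for m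
  proof -
    have "m + m = 2 *s m" by (simp add: vec_eq_iff)
    then show ?thesis using M that by (simp add: two_elementary_disc_group_iff)
  qed
  show ?thesis
  proof (rule irregular_cusp0_of_isometric_transvection[OF S D ST])
    show "?e \<in> int_vecs" by simp
    show "?e $ Inr (Inl 1) = 1" by simp
    show "bform ?T ?e ?e = 0" "bform ?T ?e ?u = 0" by simp_all
    show "transvection ?T ?e ?u x \<in> int_vecs" if x: "x \<in> int_vecs" for x
    proof -
      obtain a b s t m where "x = ?v a b s t m" using exhaust by blast
      then show ?thesis using x by (simp add: transv)
    qed
    show "transvection ?T ?e ?u x + x \<in> int_vecs" if x: "x \<in> dual_lattice ?T" for x
    proof -
      obtain a b s t m where x': "x = ?v a b s t m" using exhaust by blast
      have "transvection ?T ?e ?u x + x =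
          ?v (6 * a + 2 * b - 4 * s - 2 * (4 * t)) (2 * a + 2 * b - 4 * t) (2 * a + b - 4 * t) a (m + m)"
        by (simp add: x' transv)
      moreover have "a \<in> \<int>" "b \<in> \<int>" "4 * s \<in> \<int>" "4 * t \<in> \<int>" "m \<in> dual_lattice M"
        using x by (simp_all add: x')
      ultimately show ?thesis
        using M2 by (simp only: join_vec_int_vecs vec2_simps vec1_simps Ints_add Ints_diff Ints_mult Ints_numeral)
    qed
    show "?v 0 0 (1 / 4) 0 0 \<in> dual_lattice ?T" by simp
    show "transvection ?T ?e ?u (?v 0 0 (1 / 4) 0 0) - ?v 0 0 (1 / 4) 0 0 \<notin> int_vecs"
      by (simp add: transv)
  qed
qed

theorem proposition1p1:
  fixes S :: "int ^ 'n ^ 'n" and b :: nat and D :: "(complex ^ 'n) set set"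
  assumes "even_lattice S" and "has_signature S 2 b" and "D \<in> period_components S"
  shows "(has_irregular_cusp S D (stable_O_plus S D) \<longrightarrow>
            (\<exists>a. disc_group S \<cong>
                   integer_mod_group 8 \<times>\<times> group_power (integer_mod_group 2) a) \<or>
            (\<exists>a. disc_group S \<cong>
                   group_power (integer_mod_group 4) 2 \<times>\<times> group_power (integer_mod_group 2) a))
       \<and> (\<forall>M :: int ^ 'm ^ 'm.
            even_lattice M \<and> two_elementary (disc_group M) \<and>
            (S \<simeq>\<^sub>L lattice_U \<oplus>\<^sub>L rank_one (-8) \<oplus>\<^sub>L M \<or>
             S \<simeq>\<^sub>L lattice_U \<oplus>\<^sub>L rank_one (-4) \<oplus>\<^sub>L rank_one (-4) \<oplus>\<^sub>L M) \<longrightarrow>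
            has_irregular_cusp0 S D (stable_O_plus S D))"
proof (intro conjI impI allI)
  assume "has_irregular_cusp S D (stable_O_plus S D)"
  then show "(\<exists>a. disc_group S \<cong>
                   integer_mod_group 8 \<times>\<times> group_power (integer_mod_group 2) a) \<or>
            (\<exists>a. disc_group S \<cong>
                   group_power (integer_mod_group 4) 2 \<times>\<times> group_power (integer_mod_group 2) a)"
    unfolding has_irregular_cusp_def
    using disc_group_of_irregular_cusp0[OF assms(1,3)] disc_group_of_irregular_cusp1[OF assms(1,3)]
    by (elim disjE)
next
  fix M :: "int ^ 'm ^ 'm"
  assume "even_lattice M \<and> two_elementary (disc_group M) \<and>
    (S \<simeq>\<^sub>L lattice_U \<oplus>\<^sub>L rank_one (-8) \<oplus>\<^sub>L M \<or>
     S \<simeq>\<^sub>L lattice_U \<oplus>\<^sub>L rank_one (-4) \<oplus>\<^sub>L rank_one (-4) \<oplus>\<^sub>L M)"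
  then show "has_irregular_cusp0 S D (stable_O_plus S D)"
    using irregular_cusp0_U_8[OF assms(1,3)] irregular_cusp0_U_4_4[OF assms(1,3)] by blast
qed

end
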